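(* Let $G$ be a threshold graph on vertices $0,1,\dots,n$. Then \[\operatorname{Ehr}_{q, 1}(\mathcal{F}_G(-n,1,\dots,1)) = t_G(1,q) = I_G(q) = \sum_{T} q^{\operatorname{inv}(T)} = \sum_{P} q^{\operatorname{codeg}(P)},\] where $T$ ranges over all spanning trees of $G$, and $P$ ranges over all $G$-parking functions.
   Context: A threshold graph is a graph built from a single vertex by repeatedly adding either a dominating vertex or an isolated vertex; its vertices are labeled $0,\dots,n$ by reverse degree sequence ($d_i\ge d_j$ for $i<j$), and each edge is directed from $i$ to $j$ if $i>j$. For $\mathbf a\in\mathbf Z^{n+1}$ with entries summing to $0$, the flow polytope $\mathcal F_G(\mathbf a)=\{x\in\mathbf R_{\ge0}^E : A_G x=\mathbf a\}$, where $A_G$ has columns $e_i-e_j$ for each directed edge $(i,j)$ (nonnegative flows on edges with netflow $\mathbf a$ at the vertices). For integer $b\ge 0$, $wt_{q,t}(b)=\frac{q^b-t^b}{q-t}$ if $b>0$ and $1$ if $b=0$; for a lattice point $A=(a_{ij})$, $wt_{q,t}(A)=(-(1-t)(1-q))^{\#\{a_{ij}>0\}-n}\prod_{i,j} wt_{q,t}(a_{ij})$; and $\operatorname{Ehr}_{q,t}(\mathcal F_G(\mathbf a))=\sum_{A\in\mathcal F_G(\mathbf a)\cap\mathbf Z^E} wt_{q,t}(A)$. The Tutte polynomial is $t_G(x,y)=\sum_{A\subseteq E}(x-1)^{k(A)-k(E)}(y-1)^{k(A)+|A|-|V|}$, $k(A)$ the number of connected components of $(V,A)$. For a spanning tree $T$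 rooted at $0$, an inversion is a pair $(i,j)$ with $0\ne i>j$ and $j$ a descendant of $i$; $\operatorname{inv}(T)$ counts them; a $\kappa$-inversion is an inversion $(i,j)$ with $j$ adjacent in $G$ to the parent of $i$, and $I_G(q)=\sum_T q^{\kappa(T)}$. A $G$-parking function is $P:[n]\to\mathbf Z_{\ge0}$ such that every nonempty $S\subseteq[n]$ contains some $i$ with $P(i)$ less than the number of vertices $j\notin S$ adjacent to $i$; $\operatorname{codeg}(P)=|E|-|V|+1-\sum_i P(i)$.
   Formalization: The equality with t_G(1,q) is stated only for connected G; for disconnected G (e.g. n=1 with no edges) t_G(1,q) is nonzero while the other four expressions are 0. All other equalities are stated for every threshold graph. *)

theory Defs
  imports "HOL-Computational_Algebra.Polynomial" "HOL-Library.FuncSet"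
begin

text \<open>
  A finite simple graph is a vertex set \<open>V\<close> together with a set \<open>E\<close> of two-element subsets of \<open>V\<close>.
\<close>

inductive threshold :: "'a set \<Rightarrow> 'a set set \<Rightarrow> bool" where
  single: "threshold {v} {}"
| isolated: "threshold V E \<Longrightarrow> v \<notin> V \<Longrightarrow> threshold (insert v V) E"
| dominating: "threshold V E \<Longrightarrow> v \<notin> V \<Longrightarrow> threshold (insert v V) (E \<union> {{v, u} | u. u \<in> V})"

definition deg :: "'a set set \<Rightarrow> 'a \<Rightarrow> nat" where
  "deg E v = card {e \<in> E. v \<in> e}"

definition threshold_graph :: "nat \<Rightarrow> nat set set \<Rightarrow> bool" where
  "threshold_graph n E \<longleftrightarrow>
     threshold {0..n} E \<and> (\<forall>i j. i < j \<and> j \<le> n \<longrightarrow> deg E j \<le> deg E i)"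


subsection \<open>Connectedness and the Tutte polynomial\<close>

definition conn_rel :: "'a set \<Rightarrow> 'a set set \<Rightarrow> ('a \<times> 'a) set" where
  "conn_rel V A = {(u, v). {u, v} \<in> A}\<^sup>* \<inter> V \<times> V"

definition num_components :: "'a set \<Rightarrow> 'a set set \<Rightarrow> nat" where
  "num_components V A = card (V // conn_rel V A)"

definition connected_graph :: "'a set \<Rightarrow> 'a set set \<Rightarrow> bool" where
  "connected_graph V A \<longleftrightarrow> V \<noteq> {} \<and> conn_rel V A = V \<times> V"

text \<open>
  For \<open>A \<subseteq> E\<close> both exponents are nonnegative integers, so the subtractions on \<^typ>\<open>nat\<close> do not
  truncate.
\<close>

definition tutte :: "'a set \<Rightarrow> 'a set set \<Rightarrow> 'r::comm_ring_1 \<Rightarrow> 'r \<Rightarrow> 'r" where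
  "tutte V E x y =
     (\<Sum>A\<in>Pow E. (x - 1) ^ (num_components V A - num_components V E)
                 * (y - 1) ^ (num_components V A + card A - card V))"


subsection \<open>Spanning trees and inversions\<close>

definition simple_path :: "'a set set \<Rightarrow> 'a list \<Rightarrow> bool" where
  "simple_path T p \<longleftrightarrow>
     p \<noteq> [] \<and> distinct p \<and> (\<forall>k. Suc k < length p \<longrightarrow> {p ! k, p ! Suc k} \<in> T)"

definition acyclic_graph :: "'a set set \<Rightarrow> bool" where
  "acyclic_graph T \<longleftrightarrow> \<not> (\<exists>p. simple_path T p \<and> 3 \<le> length p \<and> {last p, hd p} \<in> T)"

definition spanning_trees :: "'a set \<Rightarrow> 'a set set \<Rightarrow> 'a set set set" where
  "spanning_trees V E = {T. T \<subseteq> E \<and> connected_graph V T \<and> acyclic_graph T}"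

definition descendant :: "nat set set \<Rightarrow> nat \<Rightarrow> nat \<Rightarrow> bool" where
  "descendant T i j \<longleftrightarrow>
     i \<noteq> j \<and> (\<exists>p. simple_path T p \<and> hd p = 0 \<and> last p = j \<and> i \<in> set p)"

definition is_parent :: "nat set set \<Rightarrow> nat \<Rightarrow> nat \<Rightarrow> bool" where
  "is_parent T k i \<longleftrightarrow> (\<exists>p. simple_path T (p @ [k, i]) \<and> hd (p @ [k, i]) = 0)"

definition inversions :: "nat set set \<Rightarrow> (nat \<times> nat) set" where
  "inversions T = {(i, j). i \<noteq> 0 \<and> i > j \<and> descendant T i j}"

definition inv_num :: "nat set set \<Rightarrow> nat" where
  "inv_num T = card (inversions T)"

definition kappa :: "nat set set \<Rightarrow> nat set set \<Rightarrow> nat" where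
  "kappa E T = card {(i, j) \<in> inversions T. \<exists>k. is_parent T k i \<and> {j, k} \<in> E}"

definition inversion_enumerator :: "nat \<Rightarrow> nat set set \<Rightarrow> 'r::comm_semiring_1 \<Rightarrow> 'r" where
  "inversion_enumerator n E q = (\<Sum>T\<in>spanning_trees {0..n} E. q ^ kappa E T)"


subsection \<open>Parking functions\<close>

definition parking_functions :: "nat \<Rightarrow> nat set set \<Rightarrow> (nat \<Rightarrow> nat) set" where
  "parking_functions n E =
     {P \<in> {1..n} \<rightarrow>\<^sub>E UNIV.
        \<forall>S\<subseteq>{1..n}. S \<noteq> {} \<longrightarrow> (\<exists>i\<in>S. P i < card {j \<in> {0..n} - S. {i, j} \<in> E})}"

definition codeg :: "nat \<Rightarrow> nat set set \<Rightarrow> (nat \<Rightarrow> nat) \<Rightarrow> int" where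
  "codeg n E P = int (card E) - int (card {0..n}) + 1 - int (\<Sum>i\<in>{1..n}. P i)"

lemma codeg_nonneg:
  assumes E: "\<forall>e\<in>E. e \<subseteq> {0..n}" and P: "P \<in> parking_functions n E"
  shows "codeg n E P \<ge> 0"
proof -
  have "E \<subseteq> Pow {0..n}"
    using E by blast
  then have fin: "finite E"
    by (rule finite_subset) simp
  have main: "(\<Sum>i\<in>S. P i + 1) \<le> card {e \<in> E. e \<inter> S \<noteq> {}}" if "finite S" "S \<subseteq> {1..n}" for S
    using that
  proof (induction S rule: finite_psubset_induct)
    case (psubset S)
    show ?case
    proof (cases "S = {}")
      case False
      then obtain i where i: "i \<in> S" and less: "P i < card {j \<in> {0..n} - S. {i, j} \<in> E}"
        using P psubset.prems unfolding parking_functions_def by blast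
      let ?J = "{j \<in> {0..n} - S. {i, j} \<in> E}"
      let ?A = "{e \<in> E. e \<inter> (S - {i}) \<noteq> {}}"
      have "(\<Sum>k\<in>S - {i}. P k + 1) \<le> card ?A"
        using psubset.prems i by (intro psubset.IH) auto
      moreover have "card ((\<lambda>j. {i, j}) ` ?J) = card ?J"
        by (rule card_image) (auto simp: inj_on_def doubleton_eq_iff)
      moreover have "card (?A \<union> (\<lambda>j. {i, j}) ` ?J) = card ?A + card ((\<lambda>j. {i, j}) ` ?J)"
        using fin by (intro card_Un_disjoint) auto
      moreover have "card (?A \<union> (\<lambda>j. {i, j}) ` ?J) \<le> card {e \<in> E. e \<inter> S \<noteq> {}}"
        using fin i by (intro card_mono) auto
      moreover have "(\<Sum>k\<in>S. P k + 1) = (P i + 1) + (\<Sum>k\<in>S - {i}. P k + 1)"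
        using psubset.hyps i by (rule sum.remove)
      ultimately show ?thesis
        using less by linarith
    qed simp
  qed
  have "(\<Sum>i\<in>{1..n}. P i + 1) \<le> card {e \<in> E. e \<inter> {1..n} \<noteq> {}}"
    by (rule main) auto
  also have "\<dots> \<le> card E"
    using fin by (intro card_mono) auto
  finally have "(\<Sum>i\<in>{1..n}. P i) + n \<le> card E"
    by (simp only: sum.distrib) simp
  then have "int (\<Sum>i\<in>{1..n}. P i) + int n \<le> int (card E)"
    by linarith
  then show ?thesis
    unfolding codeg_def by simp
qed


subsection \<open>Flow polytopes and the weighted Ehrhart function\<close>

definition dedges :: "nat set set \<Rightarrow> (nat \<times> nat) set" where
  "dedges E = {(i, j). {i, j} \<in> E \<and> i > j}"

definition incidence :: "nat \<Rightarrow> nat \<times> nat \<Rightarrow> real" where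
  "incidence v e = of_bool (v = fst e) - of_bool (v = snd e)"

definition flow_polytope :: "nat \<Rightarrow> nat set set \<Rightarrow> (nat \<Rightarrow> int) \<Rightarrow> (nat \<times> nat \<Rightarrow> real) set" where
  "flow_polytope n E a =
     {x \<in> dedges E \<rightarrow>\<^sub>E {0..}.
        \<forall>v\<in>{0..n}. (\<Sum>e\<in>dedges E. incidence v e * x e) = of_int (a v)}"

definition lattice_flows :: "nat \<Rightarrow> nat set set \<Rightarrow> (nat \<Rightarrow> int) \<Rightarrow> (nat \<times> nat \<Rightarrow> real) set" where
  "lattice_flows n E a = {x \<in> flow_polytope n E a. \<forall>e\<in>dedges E. x e \<in> \<int>}"

text \<open>
  The ring of polynomials in \<open>q\<close> and \<open>t\<close> over the integers is \<^typ>\<open>int poly poly\<close>: the inner variable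
  is \<open>q\<close>, the outer variable is \<open>t\<close>. Thus evaluating by \<^const>\<open>poly\<close> at \<open>1\<close> is the specialization
  \<open>t = 1\<close>, with result a polynomial in \<open>q\<close>.
\<close>

definition qvar :: "int poly" where
  "qvar = [:0, 1:]"

definition q2 :: "int poly poly" where
  "q2 = [:qvar:]"

definition t2 :: "int poly poly" where
  "t2 = [:0, 1:]"

definition wt :: "nat \<Rightarrow> int poly poly" where
  "wt b = (if b > 0 then (q2 ^ b - t2 ^ b) div (q2 - t2) else 1)"

lemma wt_exact: "wt b * (q2 - t2) = (if b > 0 then q2 ^ b - t2 ^ b else q2 - t2)"
proof -
  have "(q2 - t2) dvd (q2 ^ b - t2 ^ b)"
    by (simp add: power_diff_sumr2)
  then show ?thesis
    by (simp add: wt_def)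
qed

text \<open>
  If the netflow is positive at every vertex of \<open>{1..n}\<close>, then the exponent below is a nonnegative
  integer, so the subtraction on \<^typ>\<open>nat\<close> does not truncate; see \<open>lattice_flow_support\<close>.
\<close>

definition wt_flow :: "nat \<Rightarrow> nat set set \<Rightarrow> (nat \<times> nat \<Rightarrow> real) \<Rightarrow> int poly poly" where
  "wt_flow n E x =
     (- ((1 - t2) * (1 - q2))) ^ (card {e \<in> dedges E. x e > 0} - n)
     * (\<Prod>e\<in>dedges E. wt (nat \<lfloor>x e\<rfloor>))"

definition ehr_qt :: "nat \<Rightarrow> nat set set \<Rightarrow> (nat \<Rightarrow> int) \<Rightarrow> int poly poly" where
  "ehr_qt n E a = (\<Sum>x\<in>lattice_flows n E a. wt_flow n E x)"

lemma dedges_subset: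
  assumes "\<forall>e\<in>E. e \<subseteq> {0..n}"
  shows "dedges E \<subseteq> {0..n} \<times> {0..n}"
  using assms by (fastforce simp: dedges_def)

lemma lattice_flow_support:
  assumes E: "\<forall>e\<in>E. e \<subseteq> {0..n}" and a: "\<forall>v\<in>{1..n}. a v > 0"
    and x: "x \<in> flow_polytope n E a"
  shows "n \<le> card {e \<in> dedges E. x e > 0}"
proof -
  have fin: "finite (dedges E)"
    using dedges_subset[OF E] by (rule finite_subset) simp
  have nonneg: "x e \<ge> 0" if "e \<in> dedges E" for e
    using x that by (cases e) (auto simp: flow_polytope_def PiE_def Pi_def)
  have "v \<in> fst ` {e \<in> dedges E. x e > 0}" if v: "v \<in> {1..n}" for v
  proof (rule ccontr)
    assume *: "v \<notin> fst ` {e \<in> dedges E. x e > 0}"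
    have "(\<Sum>e\<in>dedges E. incidence v e * x e) \<le> 0"
    proof (rule sum_nonpos)
      fix e assume e: "e \<in> dedges E"
      show "incidence v e * x e \<le> 0"
        using * nonneg[OF e] e by (cases e; cases "x e = 0") (force simp: incidence_def image_iff)+
    qed
    moreover have "(\<Sum>e\<in>dedges E. incidence v e * x e) = of_int (a v)"
      using x v by (simp add: flow_polytope_def)
    ultimately show False
      using a v by (metis of_int_0_less_iff not_le)
  qed
  then have "{1..n} \<subseteq> fst ` {e \<in> dedges E. x e > 0}"
    by blast
  then have "card {1..n} \<le> card {e \<in> dedges E. x e > 0}"
    using fin by (intro surj_card_le) auto
  then show ?thesis
    by simp
qed

lemma finite_lattice_flows:
  assumes E: "\<forall>e\<in>E. e \<subseteq> {0..n}"
  shows "finite (lattice_flows n E a)"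
proof -
  have sub: "dedges E \<subseteq> {0..n} \<times> {0..n}"
    using E by (rule dedges_subset)
  have fin: "finite (dedges E)"
    using sub by (rule finite_subset) simp
  define B where "B = (\<Sum>v\<in>{0..n}. int v * a v)"
  have "x \<in> dedges E \<rightarrow>\<^sub>E (of_int ` {0..B})" if x: "x \<in> lattice_flows n E a" for x
  proof -
    have nonneg: "x e \<ge> 0" if "e \<in> dedges E" for e
      using x that by (cases e) (auto simp: lattice_flows_def flow_polytope_def PiE_def Pi_def)
    have "real_of_int B = (\<Sum>v\<in>{0..n}. real v * (\<Sum>e\<in>dedges E. incidence v e * x e))"
      using x by (simp add: B_def lattice_flows_def flow_polytope_def)
    also have "\<dots> = (\<Sum>e\<in>dedges E. (\<Sum>v\<in>{0..n}. real v * incidence v e) * x e)"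
      by (simp add: sum_distrib_left sum_distrib_right mult.assoc) (rule sum.swap)
    also have "\<dots> = (\<Sum>e\<in>dedges E. (real (fst e) - real (snd e)) * x e)"
    proof (rule sum.cong[OF refl])
      fix e assume "e \<in> dedges E"
      then have "fst e \<in> {0..n}" "snd e \<in> {0..n}"
        using sub by auto
      then have "(\<Sum>v\<in>{0..n}. real v * incidence v e) = real (fst e) - real (snd e)"
        by (simp add: incidence_def right_diff_distrib sum_subtractf of_bool_def
              if_distrib[of "\<lambda>z. _ * z"] cong: if_cong)
      then show "(\<Sum>v\<in>{0..n}. real v * incidence v e) * x e = (real (fst e) - real (snd e)) * x e"
        by simp
    qed
    finally have B: "real_of_int B = (\<Sum>e\<in>dedges E. (real (fst e) - real (snd e)) * x e)" .
    have ge: "x e \<le> (real (fst e) - real (snd e)) * x e" if e: "e \<in> dedges E" for e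
    proof -
      have "1 \<le> real (fst e) - real (snd e)"
        using e by (auto simp: dedges_def)
      from mult_right_mono[OF this nonneg[OF e]] show ?thesis by simp
    qed
    have "x e \<in> of_int ` {0..B}" if e: "e \<in> dedges E" for e
    proof -
      have "x e \<le> (\<Sum>e\<in>dedges E. (real (fst e) - real (snd e)) * x e)"
        using ge[OF e] by (rule order_trans)
          (rule member_le_sum[OF e _ fin], use ge nonneg in \<open>force intro: order_trans\<close>)
      then have "x e \<le> real_of_int B" using B by simp
      moreover obtain z where "x e = of_int z"
        using x e by (auto simp: lattice_flows_def elim: Ints_cases)
      ultimately show ?thesis
        using nonneg[OF e] by auto
    qed
    then show ?thesis
      using x by (auto simp: lattice_flows_def flow_polytope_def PiE_def)
  qed
  then have "lattice_flows n E a \<subseteq> dedges E \<rightarrow>\<^sub>E (of_int ` {0..B})"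
    by blast
  then show ?thesis
    by (rule finite_subset) (simp add: finite_PiE fin)
qed

end

theory Submission
  imports Defs
begin

text \<open>
  For connected \<open>G\<close> all five expressions equal \<open>C(V) = \<Sum> (q - 1)\<^bsup>|A| + 1 - |V|\<^esup>\<close>, the sum ranging over the
  connected spanning edge sets \<open>A\<close>. Fix a root \<open>r\<close> and another vertex \<open>v\<close>, and let \<open>B\<close> be the component
  of \<open>v\<close> after removing \<open>r\<close>. Then \<open>A\<close> splits into a connected edge set on \<open>B\<close>, one on \<open>V - B\<close>, and a
  nonempty set of edges from \<open>r\<close> to \<open>B\<close>, whence
  \<open>C(V) = \<Sum>\<^sub>B [e(r, B)]\<^sub>q C(B) C(V - B)\<close>, where \<open>e(r, B)\<close> counts the edges from \<open>r\<close> to \<open>B\<close>.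

  A threshold graph labelled by decreasing degree is shifted: replacing an endpoint of an edge by a
  smaller vertex gives an edge again. Hence every inversion is a \<open>\<kappa>\<close>-inversion, and the possible
  neighbours of \<open>r\<close> in \<open>B\<close> form an initial segment of \<open>B\<close>, so that the inversion enumerator of
  spanning trees satisfies the recursion for every root.

  At \<open>t = 1\<close> only the flows supported on \<open>n\<close> edges survive. These correspond to the trees increasing
  away from \<open>0\<close>, each edge carrying the size of the branch above it. Their enumerator satisfies the
  recursion with \<open>r\<close> the least vertex: in a shifted graph, such an \<open>r\<close> is adjacent to all of a
  connected \<open>B\<close> with at least two elements, so \<open>e(r, B) = |B|\<close>.

  Parking functions and connected edge sets both satisfy the deletion-contraction recursion of the
  burning algorithm, in any graph.
\<close>

section \<open>Connected edge sets\<close>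

text \<open>Connectedness by cuts rather than paths, so that gluing and splitting become case
  distinctions on a cut. Only edges with both ends in \<open>V\<close> are seen, hence
  \<open>conn B A\<close> makes sense for \<open>B \<subseteq> V\<close> without restricting
  \<open>A\<close>.\<close>

definition conn :: "'a set \<Rightarrow> 'a set set \<Rightarrow> bool" where
  "conn V A \<longleftrightarrow>
     V \<noteq> {} \<and> (\<forall>S\<subseteq>V. S \<noteq> {} \<longrightarrow> S \<noteq> V \<longrightarrow> (\<exists>a\<in>S. \<exists>b\<in>V - S. {a, b} \<in> A))"

lemma conn_cut:
  assumes "conn V A" "S \<subseteq> V" "S \<noteq> {}" "S \<noteq> V"
  obtains a b where "a \<in> S" "b \<in> V - S" "{a, b} \<in> A"
  using assms unfolding conn_def by meson

text \<open>Edges crossing a cut also cross its complement, so it suffices to test the side that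
  avoids \<open>r\<close>.\<close>

lemma conn_root:
  assumes r: "r \<in> V"
  shows "conn V A \<longleftrightarrow> (\<forall>S\<subseteq>V - {r}. S \<noteq> {} \<longrightarrow> (\<exists>a\<in>S. \<exists>b\<in>V - S. {a, b} \<in> A))"
proof
  assume "conn V A"
  then show "\<forall>S\<subseteq>V - {r}. S \<noteq> {} \<longrightarrow> (\<exists>a\<in>S. \<exists>b\<in>V - S. {a, b} \<in> A)"
    using r unfolding conn_def by (metis Diff_iff Diff_subset singletonI subset_iff)
next
  assume *: "\<forall>S\<subseteq>V - {r}. S \<noteq> {} \<longrightarrow> (\<exists>a\<in>S. \<exists>b\<in>V - S. {a, b} \<in> A)"
  have "\<exists>a\<in>S. \<exists>b\<in>V - S. {a, b} \<in> A" if S: "S \<subseteq> V" "S \<noteq> {}" "S \<noteq> V" for S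
  proof (cases "r \<in> S")
    case False
    then show ?thesis
      using * S by (metis subset_Diff_insert Diff_empty)
  next
    case True
    then have "V - S \<subseteq> V - {r}" "V - S \<noteq> {}"
      using S by auto
    then obtain a b where "a \<in> V - S" "b \<in> V - (V - S)" "{a, b} \<in> A"
      using * by meson
    then show ?thesis
      by (metis DiffD1 DiffD2 DiffI insert_commute)
  qed
  then show "conn V A"
    using r unfolding conn_def by blast
qed

lemma conn_Int_Pow: "conn V (A \<inter> Pow V) \<longleftrightarrow> conn V A"
proof -
  have "{a, b} \<in> A \<inter> Pow V \<longleftrightarrow> {a, b} \<in> A" if "a \<in> S" "b \<in> V - S" "S \<subseteq> V" for a b S
    using that by auto
  then show ?thesis
    unfolding conn_def by (smt (verit))
qed

lemma conn_mono: "conn V A \<Longrightarrow> A \<subseteq> A' \<Longrightarrow> conn V A'"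
  unfolding conn_def by (meson subsetD)

section \<open>The component of a vertex after removing a root\<close>

definition component :: "'a set \<Rightarrow> 'a \<Rightarrow> 'a \<Rightarrow> 'a set set \<Rightarrow> 'a set \<Rightarrow> bool" where
  "component V r v A B \<longleftrightarrow>
     v \<in> B \<and> B \<subseteq> V - {r} \<and> (\<forall>a\<in>B. \<forall>b\<in>V - B - {r}. {a, b} \<notin> A) \<and> conn B A"

text \<open>The least set that contains \<open>v\<close> and is closed under adjacency away from
  \<open>r\<close> is connected: if no edge crossed a cut of it, the side containing
  \<open>v\<close> would be a smaller closed set.\<close>

lemma component_exists:
  assumes v: "v \<in> V" "v \<noteq> r"
  shows "\<exists>B. component V r v A B"
proof -
  define closed where
    "closed C \<longleftrightarrow> v \<in> C \<and> C \<subseteq> V - {r} \<and> (\<forall>a\<in>C. \<forall>b\<in>V - C - {r}. {a, b} \<notin> A)" for C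
  define B where "B = \<Inter>{C. closed C}"
  have top: "closed (V - {r})"
    using v by (auto simp: closed_def)
  have least: "B \<subseteq> C" if "closed C" for C
    using that by (auto simp: B_def)
  have B: "closed B"
    unfolding closed_def
  proof (intro conjI ballI)
    show "v \<in> B"
      by (auto simp: B_def closed_def)
    show "B \<subseteq> V - {r}"
      using least[OF top] .
    fix a b assume a: "a \<in> B" and b: "b \<in> V - B - {r}"
    then obtain C where "closed C" "b \<notin> C"
      by (auto simp: B_def)
    moreover from this a have "a \<in> C"
      using least by blast
    ultimately show "{a, b} \<notin> A"
      using b by (auto simp: closed_def)
  qed
  have "conn B A"
    unfolding conn_def
  proof (intro conjI allI impI)
    show "B \<noteq> {}"
      using B by (auto simp: closed_def)
    fix S assume S: "S \<subseteq> B" "S \<noteq> {}" "S \<noteq> B"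
    show "\<exists>a\<in>S. \<exists>b\<in>B - S. {a, b} \<in> A"
    proof (rule ccontr)
      assume *: "\<not> (\<exists>a\<in>S. \<exists>b\<in>B - S. {a, b} \<in> A)"
      show False
      proof (cases "v \<in> S")
        case True
        have "closed S"
          using B S * True unfolding closed_def by blast
        then show False
          using least S by blast
      next
        case False
        have "closed (B - S)"
          unfolding closed_def
        proof (intro conjI ballI)
          fix a b assume a: "a \<in> B - S" and b: "b \<in> V - (B - S) - {r}"
          show "{a, b} \<notin> A"
          proof (cases "b \<in> B")
            case True
            then have "{b, a} \<notin> A"
              using * a b by blast
            then show ?thesis
              by (simp add: insert_commute)
          next
            case False
            then show ?thesis
              using B a b by (auto simp: closed_def)
          qed
        qed (use B False in \<open>auto simp: closed_def\<close>)
        then show False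
          using least S by blast
      qed
    qed
  qed
  then show ?thesis
    using B by (auto simp: closed_def component_def)
qed

text \<open>Otherwise \<open>B \<inter> C\<close> is a cut of the connected set \<open>B\<close>,
  and an edge crossing it leaves \<open>C\<close> without ending in \<open>r\<close>.\<close>

lemma component_subset:
  assumes B: "component V r v A B" and C: "component V r v A C"
  shows "B \<subseteq> C"
proof (rule ccontr)
  assume "\<not> B \<subseteq> C"
  then have "B \<inter> C \<noteq> B"
    by blast
  moreover have "B \<inter> C \<noteq> {}"
    using B C by (auto simp: component_def)
  moreover have "conn B A"
    using B by (simp add: component_def)
  ultimately obtain a b where "a \<in> B \<inter> C" "b \<in> B - B \<inter> C" "{a, b} \<in> A"
    by (metis conn_cut inf_le1)
  then show False
    using B C unfolding component_def by blast
qed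

lemma component_unique:
  "component V r v A B \<Longrightarrow> component V r v A C \<Longrightarrow> B = C"
  by (simp add: component_subset subset_antisym)

section \<open>Splitting a connected edge set at a root\<close>

locale simple_graph =
  fixes E :: "'a set set"
  assumes edge: "e \<in> E \<Longrightarrow> \<exists>u v. u \<noteq> v \<and> e = {u, v}"
begin

definition conn_subs :: "'a set \<Rightarrow> 'a set set set" where
  "conn_subs V = {A. A \<subseteq> E \<and> A \<subseteq> Pow V \<and> conn V A}"

definition star :: "'a \<Rightarrow> 'a set \<Rightarrow> 'a set set" where
  "star r B = {e \<in> E. \<exists>b\<in>B. e = {r, b}}"

lemma finite_conn_subs [simp]: "finite V \<Longrightarrow> finite (conn_subs V)"
  by (rule finite_subset[of _ "Pow (Pow V)"]) (auto simp: conn_subs_def)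

lemma finite_star [simp]: "finite B \<Longrightarrow> finite (star r B)"
  by (rule finite_subset[of _ "(\<lambda>b. {r, b}) ` B"]) (auto simp: star_def)

lemma card_star: "card (star r B) = card {b \<in> B. {r, b} \<in> E}"
proof -
  have "star r B = (\<lambda>b. {r, b}) ` {b \<in> B. {r, b} \<in> E}"
    by (auto simp: star_def)
  moreover have "inj_on (\<lambda>b. {r, b}) {b \<in> B. {r, b} \<in> E}"
    by (auto simp: inj_on_def doubleton_eq_iff)
  ultimately show ?thesis
    by (simp add: card_image)
qed

lemma conn_subs_finite: "A \<in> conn_subs V \<Longrightarrow> finite V \<Longrightarrow> finite A"
  by (auto simp: conn_subs_def intro: finite_subset[of _ "Pow V"])

text \<open>The three kinds of edges are told apart by their position: inside \<open>B\<close>,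
  outside \<open>B\<close>, or from \<open>r\<close> into \<open>B\<close>. Only the empty set lies
  in both \<open>Pow B\<close> and \<open>Pow (V - B)\<close>, and it is not an edge.\<close>

lemma glue_parts:
  assumes B: "B \<subseteq> V - {r}" and X: "X \<subseteq> star r B" and A1: "A1 \<subseteq> E" "A1 \<subseteq> Pow B"
    and A2: "A2 \<subseteq> E" "A2 \<subseteq> Pow (V - B)"
  shows "(X \<union> A1 \<union> A2) \<inter> Pow B = A1" "(X \<union> A1 \<union> A2) \<inter> Pow (V - B) = A2"
    "(X \<union> A1 \<union> A2) \<inter> star r B = X" "X \<inter> A1 = {}" "(X \<union> A1) \<inter> A2 = {}"
proof -
  have "e \<noteq> {}" if "e \<in> E" for e
    using edge[OF that] by auto
  then have "{} \<notin> A1" "{} \<notin> A2"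
    using A1 A2 by blast+
  then have "A1 \<inter> Pow (V - B) = {}" "A2 \<inter> Pow B = {}"
    using A1 A2 by (auto simp: subset_iff)
  moreover have "\<not> e \<subseteq> B" "\<not> e \<subseteq> V - B" if "e \<in> star r B" for e
    using that B by (auto simp: star_def)
  ultimately show "(X \<union> A1 \<union> A2) \<inter> Pow B = A1" "(X \<union> A1 \<union> A2) \<inter> Pow (V - B) = A2"
    "(X \<union> A1 \<union> A2) \<inter> star r B = X" "X \<inter> A1 = {}" "(X \<union> A1) \<inter> A2 = {}"
    using X A1 A2 by blast+
qed

text \<open>A cut avoiding \<open>r\<close> misses \<open>B\<close>, contains \<open>B\<close> or
  divides \<open>B\<close>; it is crossed by an edge of \<open>A2\<close>, \<open>X\<close> or
  \<open>A1\<close>, respectively.\<close>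

lemma glue_conn:
  assumes r: "r \<in> V" and B: "B \<subseteq> V - {r}" and X: "X \<subseteq> star r B" "X \<noteq> {}"
    and A1: "A1 \<in> conn_subs B" and A2: "A2 \<in> conn_subs (V - B)"
  shows "X \<union> A1 \<union> A2 \<in> conn_subs V"
proof -
  have rB: "r \<in> V - B"
    using r B by auto
  have c1: "conn B A1" and c2: "conn (V - B) A2"
    using A1 A2 by (auto simp: conn_subs_def)
  have "\<exists>a\<in>S. \<exists>b\<in>V - S. {a, b} \<in> X \<union> A1 \<union> A2" if S: "S \<subseteq> V - {r}" "S \<noteq> {}" for S
  proof -
    consider "S \<inter> B = {}" | "B \<subseteq> S" | "S \<inter> B \<noteq> {}" "S \<inter> B \<noteq> B"
      by blast
    then show ?thesis
    proof cases
      case 1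
      then have "S \<subseteq> V - B - {r}"
        using S by auto
      then show ?thesis
        using c2 S(2) rB unfolding conn_root[OF rB] by blast
    next
      case 2
      from X obtain b where b: "b \<in> B" "{r, b} \<in> X"
        by (auto simp: star_def)
      then have "b \<in> S" "r \<in> V - S" "{b, r} \<in> X"
        using 2 r S by (auto simp: insert_commute)
      then show ?thesis
        by blast
    next
      case 3
      then obtain a b where "a \<in> S \<inter> B" "b \<in> B - S \<inter> B" "{a, b} \<in> A1"
        by (metis c1 conn_cut inf_le2)
      then show ?thesis
        using B by blast
    qed
  qed
  then have "conn V (X \<union> A1 \<union> A2)"
    unfolding conn_root[OF r] by blast
  moreover have "X \<subseteq> E" "X \<subseteq> Pow V"
    using X r B by (auto simp: star_def)
  ultimately show ?thesis
    using A1 A2 B unfolding conn_subs_def by blast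
qed

lemma glue_component:
  assumes v: "v \<in> B" and B: "B \<subseteq> V - {r}" and X: "X \<subseteq> star r B"
    and A1: "A1 \<in> conn_subs B" and A2: "A2 \<in> conn_subs (V - B)"
  shows "component V r v (X \<union> A1 \<union> A2) B"
  unfolding component_def
proof (intro conjI ballI)
  show "conn B (X \<union> A1 \<union> A2)"
    using A1 by (auto simp: conn_subs_def elim: conn_mono)
  fix a b assume "a \<in> B" "b \<in> V - B - {r}"
  then show "{a, b} \<notin> X \<union> A1 \<union> A2"
    using X A1 A2 B by (auto simp: conn_subs_def star_def doubleton_eq_iff)
qed (use v B in auto)

text \<open>By closedness, every edge of \<open>A\<close> leaving \<open>B\<close> ends in
  \<open>r\<close>. So some edge joins \<open>r\<close> to \<open>B\<close>. Moreover, an edge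
  crossing a cut of \<open>V - B\<close> that avoids \<open>r\<close> cannot end in
  \<open>B\<close>, which leaves \<open>V - B\<close> connected.\<close>

lemma component_split:
  assumes r: "r \<in> V" and A: "A \<in> conn_subs V" and B: "component V r v A B"
  shows "A \<inter> star r B \<noteq> {}" "A \<inter> Pow B \<in> conn_subs B" "A \<inter> Pow (V - B) \<in> conn_subs (V - B)"
    "A = (A \<inter> star r B) \<union> (A \<inter> Pow B) \<union> (A \<inter> Pow (V - B))"
proof -
  have AE: "A \<subseteq> E" "A \<subseteq> Pow V" and cA: "conn V A"
    using A by (auto simp: conn_subs_def)
  have BV: "B \<subseteq> V - {r}" "B \<noteq> {}" and cl: "\<And>a b. a \<in> B \<Longrightarrow> b \<in> V - B - {r} \<Longrightarrow> {a, b} \<notin> A"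
    and cB: "conn B A"
    using B by (auto simp: component_def)
  have rB: "r \<in> V - B"
    using r BV by auto
  obtain a b where ab: "a \<in> B" "b \<in> V - B" "{a, b} \<in> A"
    using cA BV unfolding conn_root[OF r] by blast
  then have "b = r"
    using cl by blast
  then have "{r, a} \<in> A \<inter> star r B"
    using ab AE by (auto simp: star_def insert_commute)
  then show "A \<inter> star r B \<noteq> {}"
    by blast
  show "A \<inter> Pow B \<in> conn_subs B"
    using AE cB by (auto simp: conn_subs_def conn_Int_Pow)
  have "conn (V - B) A"
    unfolding conn_root[OF rB]
  proof (intro allI impI)
    fix S assume S: "S \<subseteq> V - B - {r}" "S \<noteq> {}"
    then have "S \<subseteq> V - {r}"
      by auto
    then obtain a b where ab: "a \<in> S" "b \<in> V - S" "{a, b} \<in> A"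
      using cA S(2) unfolding conn_root[OF r] by blast
    then have "b \<notin> B"
      using cl[of b a] S by (auto simp: insert_commute)
    then show "\<exists>a\<in>S. \<exists>b\<in>V - B - S. {a, b} \<in> A"
      using ab by blast
  qed
  then show "A \<inter> Pow (V - B) \<in> conn_subs (V - B)"
    using AE by (auto simp: conn_subs_def conn_Int_Pow)
  have "e \<in> star r B \<or> e \<subseteq> B \<or> e \<subseteq> V - B" if e: "e \<in> A" for e
  proof -
    obtain a b where ab: "a \<noteq> b" "e = {a, b}"
      using edge AE e by blast
    then have "a \<in> V" "b \<in> V" "{a, b} \<in> A" "{b, a} \<in> A" "{a, b} \<in> E"
      using AE e by (auto simp: insert_commute)
    then show ?thesis
      using cl[of a b] cl[of b a] ab by (auto simp: star_def)
  qed
  then show "A = (A \<inter> star r B) \<union> (A \<inter> Pow B) \<union> (A \<inter> Pow (V - B))"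
    by blast
qed

text \<open>The bijection behind the recursion. Its inverse sends \<open>A\<close> to the component
  \<open>B\<close> of \<open>v\<close> after removing \<open>r\<close> and cuts \<open>A\<close>
  into the edges between \<open>r\<close> and \<open>B\<close>, within \<open>B\<close> and outside
  \<open>B\<close>.\<close>

lemma bij_betw_conn_subs:
  assumes r: "r \<in> V" and v: "v \<in> V - {r}"
  shows "bij_betw (\<lambda>(B, X, A1, A2). X \<union> A1 \<union> A2)
    (SIGMA B:{B. v \<in> B \<and> B \<subseteq> V - {r}}.
      (Pow (star r B) - {{}}) \<times> conn_subs B \<times> conn_subs (V - B))
    (conn_subs V)" (is "bij_betw ?f ?D _")
proof (rule bij_betw_imageI)
  show "inj_on ?f ?D"
  proof (rule inj_onI)
    fix x y assume x: "x \<in> ?D" and y: "y \<in> ?D" and eq: "?f x = ?f y"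
    obtain B X A1 A2 where x': "x = (B, X, A1, A2)"
      by (cases x) auto
    obtain B' X' A1' A2' where y': "y = (B', X', A1', A2')"
      by (cases y) auto
    have "component V r v (?f x) B"
      using x unfolding x' by (auto intro!: glue_component)
    moreover have "component V r v (?f y) B'"
      using y unfolding y' by (auto intro!: glue_component)
    ultimately have BB: "B' = B"
      using eq component_unique by metis
    have "?f x \<inter> Pow B = A1" "?f x \<inter> Pow (V - B) = A2" "?f x \<inter> star r B = X"
      using x glue_parts[of B V r X A1 A2] unfolding x' by (auto simp: conn_subs_def)
    moreover have "?f y \<inter> Pow B = A1'" "?f y \<inter> Pow (V - B) = A2'" "?f y \<inter> star r B = X'"
      using y glue_parts[of B V r X' A1' A2'] unfolding y' BB by (auto simp: conn_subs_def)
    ultimately show "x = y"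
      using eq BB x' y' by metis
  qed
  show "?f ` ?D = conn_subs V"
  proof (intro equalityI subsetI)
    fix A assume "A \<in> ?f ` ?D"
    then obtain B X A1 A2 where "(B, X, A1, A2) \<in> ?D" "A = X \<union> A1 \<union> A2"
      by auto
    then show "A \<in> conn_subs V"
      using glue_conn[OF r, of B X A1 A2] by simp
  next
    fix A assume A: "A \<in> conn_subs V"
    obtain B where B: "component V r v A B"
      using component_exists[of v V r A] v by auto
    note split = component_split[OF r A B]
    have "(B, A \<inter> star r B, A \<inter> Pow B, A \<inter> Pow (V - B)) \<in> ?D"
      using split(1-3) B by (simp add: component_def)
    then show "A \<in> ?f ` ?D"
      by (rule rev_image_eqI) (simp only: split(4)[symmetric] prod.case)
  qed
qed

lemma conn_subs_singleton: "conn_subs {r} = {{}}"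
proof -
  have "A = {}" if "A \<subseteq> E" "A \<subseteq> Pow {r}" for A
  proof (rule ccontr)
    assume "A \<noteq> {}"
    then obtain e where "e \<in> A"
      by blast
    then have "e \<in> E" "e \<subseteq> {r}"
      using that by auto
    then show False
      using edge[of e] by auto
  qed
  moreover have "conn {r} A" for A
    by (auto simp: conn_def)
  ultimately show ?thesis
    by (auto simp: conn_subs_def)
qed

lemma conn_subs_glue_card:
  assumes "finite V" "B \<subseteq> V - {r}" "X \<subseteq> star r B" "A1 \<in> conn_subs B" "A2 \<in> conn_subs (V - B)"
  shows "card (X \<union> A1 \<union> A2) = card X + card A1 + card A2"
proof -
  have fin: "finite B" "finite (V - B)"
    using assms finite_subset[of B V] by auto
  have "finite X"
    using fin assms(3) finite_star finite_subset by metis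
  moreover have "finite A1" "finite A2"
    using assms fin conn_subs_finite by auto
  moreover have "X \<inter> A1 = {}" "(X \<union> A1) \<inter> A2 = {}"
    using assms glue_parts[of B V r X A1 A2] by (auto simp: conn_subs_def)
  ultimately show ?thesis
    by (simp add: card_Un_disjoint)
qed

text \<open>This bound makes \<open>card A + 1 - card V\<close> an exact subtraction. Induction
  along the split: each part has at least one edge less than vertices, and at least one more edge
  joins \<open>r\<close> to \<open>B\<close>.\<close>

lemma conn_subs_card:
  assumes "finite V" "A \<in> conn_subs V"
  shows "card V \<le> card A + 1"
  using assms
proof (induction "card V" arbitrary: V A rule: less_induct)
  case less
  have "V \<noteq> {}"
    using less.prems by (auto simp: conn_subs_def conn_def)
  then obtain r where r: "r \<in> V"
    by blast
  show ?case
  proof (cases "V = {r}")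
    case False
    then obtain v where v: "v \<in> V - {r}"
      using r by blast
    obtain B where B: "component V r v A B"
      using component_exists[of v V r A] v by auto
    note split = component_split[OF r less.prems(2) B]
    have BV: "B \<subset> V" "V - B \<subset> V" "B \<subseteq> V - {r}"
      using B r by (auto simp: component_def)
    have "card B \<le> card (A \<inter> Pow B) + 1" "card (V - B) \<le> card (A \<inter> Pow (V - B)) + 1"
      using less.hyps[OF psubset_card_mono _ split(2)] less.hyps[OF psubset_card_mono _ split(3)]
        BV less.prems(1) finite_subset[of B V] by auto
    moreover have "card A = card (A \<inter> star r B) + card (A \<inter> Pow B) + card (A \<inter> Pow (V - B))"
      using conn_subs_glue_card[OF less.prems(1) BV(3) Int_lower2[of A] split(2,3)]
      unfolding split(4)[symmetric] .
    moreover have "card (A \<inter> star r B) > 0"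
      using split less.prems conn_subs_finite by (auto simp: card_gt_0_iff)
    moreover have "card V = card B + card (V - B)"
      using BV less.prems(1) card_mono[of V B] by (simp add: card_Diff_subset finite_subset psubset_imp_subset)
    ultimately show ?thesis
      by linarith
  qed auto
qed

end

section \<open>Enumerating connected edge sets\<close>

text \<open>The \<open>q\<close>-integer \<open>[k]_q\<close>, written as a sum so that no division
  by \<open>q - 1\<close> occurs.\<close>

definition qint :: "'r::comm_semiring_1 \<Rightarrow> nat \<Rightarrow> 'r" where
  "qint q k = (\<Sum>i<k. q ^ i)"

lemma qint_simps [simp]: "qint q 0 = 0" "qint q (Suc k) = qint q k + q ^ k"
  by (simp_all add: qint_def)

lemma sum_Pow_insert:
  assumes "finite S" "a \<notin> S"
  shows "(\<Sum>X\<in>Pow (insert a S). f X) = (\<Sum>X\<in>Pow S. f X) + (\<Sum>X\<in>Pow S. f (insert a X))"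
proof -
  have "inj_on (insert a) (Pow S)"
    using assms(2) by (auto simp: inj_on_def)
  then have "(\<Sum>X\<in>insert a ` Pow S. f X) = (\<Sum>X\<in>Pow S. f (insert a X))"
    by (simp add: sum.reindex)
  then show ?thesis
    using assms unfolding Pow_insert by (subst sum.union_disjoint) auto
qed

lemma sum_Pow_power:
  fixes y :: "'r::comm_semiring_1"
  assumes "finite S"
  shows "(\<Sum>X\<in>Pow S. y ^ card X) = (1 + y) ^ card S"
  using assms
proof (induction S)
  case (insert a S)
  have "(\<Sum>X\<in>Pow S. y ^ card (insert a X)) = (\<Sum>X\<in>Pow S. y * y ^ card X)"
    using insert by (intro sum.cong refl, subst card_insert_disjoint) (auto intro: finite_subset)
  then show ?case
    using insert by (simp add: sum_Pow_insert sum_distrib_left[symmetric] algebra_simps)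
qed simp

text \<open>Formally \<open>((1 + y) ^ k - 1) / y\<close> with \<open>k = card S\<close>. Sorting
  the subsets by whether they contain the new element gives the recursion of \<open>qint\<close>
  without dividing by \<open>y\<close>.\<close>

lemma sum_nonempty_subsets:
  fixes y :: "'r::comm_ring_1"
  assumes "finite S"
  shows "(\<Sum>X\<in>Pow S - {{}}. y ^ (card X - 1)) = qint (1 + y) (card S)"
  using assms
proof (induction S)
  case (insert a S)
  \<comment> \<open>Extending the summand by 0 to the empty set lets the sum run over a full power
    set, to which \<open>sum_Pow_insert\<close> applies.\<close>
  define f where "f X = (if X = {} then 0 else y ^ (card X - 1))" for X :: "'a set"
  have f: "(\<Sum>X\<in>Pow U - {{}}. y ^ (card X - 1)) = (\<Sum>X\<in>Pow U. f X)" if "finite U" for U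
    using that by (intro sum.mono_neutral_cong_left) (auto simp: f_def)
  have "(\<Sum>X\<in>Pow S. f (insert a X)) = (\<Sum>X\<in>Pow S. y ^ card X)"
    unfolding f_def using insert
    by (intro sum.cong refl, subst card_insert_disjoint) (auto intro: finite_subset)
  then have "(\<Sum>X\<in>Pow (insert a S). f X) = (\<Sum>X\<in>Pow S. f X) + (1 + y) ^ card S"
    using insert by (simp add: sum_Pow_insert sum_Pow_power)
  then show ?case
    using insert f[of S] f[of "insert a S"] by simp
qed simp

lemma card_split:
  assumes "finite V" "B \<subseteq> V"
  shows "card V = card B + card (V - B)"
  using assms card_mono[of V B] by (simp add: card_Diff_subset finite_subset)

text \<open>The middle weight may depend on \<open>c\<close>, since a branch of a tree is rooted at
  the vertex \<open>c\<close> where it is attached.\<close>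

lemma sum_Sigma_prod3:
  fixes f :: "'b \<Rightarrow> 'c \<Rightarrow> 'r::comm_semiring_1"
  assumes "finite I" "\<And>B. B \<in> I \<Longrightarrow> finite (P B)" "\<And>B. B \<in> I \<Longrightarrow> finite (Q B)"
    "\<And>B. B \<in> I \<Longrightarrow> finite (R B)"
  shows "(\<Sum>(B, c, S, T)\<in>(SIGMA B:I. P B \<times> Q B \<times> R B). f B c * g B c S * h B T)
    = (\<Sum>B\<in>I. (\<Sum>c\<in>P B. f B c * (\<Sum>S\<in>Q B. g B c S)) * (\<Sum>T\<in>R B. h B T))"
proof -
  have "(\<Sum>(c, S, T)\<in>P B \<times> Q B \<times> R B. f B c * g B c S * h B T)
    = (\<Sum>c\<in>P B. f B c * (\<Sum>S\<in>Q B. g B c S)) * (\<Sum>T\<in>R B. h B T)" for B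
    by (simp only: sum.cartesian_product[symmetric] sum_distrib_left[symmetric]
        sum_distrib_right[symmetric] mult.assoc)
      (simp only: sum_distrib_right mult.assoc)
  then show ?thesis
    using assms by (subst sum.Sigma[symmetric]) auto
qed

section \<open>The recursion for the enumerator of connected edge sets\<close>

context simple_graph
begin

text \<open>For finite \<open>V\<close> this is the Tutte polynomial at \<open>(1, q)\<close> of the
  induced graph if that graph is connected, and 0 otherwise; the value 0 allows the recursion to
  range over all \<open>B\<close>.\<close>

definition conn_enum :: "'r::comm_ring_1 \<Rightarrow> 'a set \<Rightarrow> 'r" where
  "conn_enum q V = (\<Sum>A\<in>conn_subs V. (q - 1) ^ (card A + 1 - card V))"

lemma conn_enum_singleton [simp]: "conn_enum q {r} = 1"
  by (simp add: conn_enum_def conn_subs_singleton)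

text \<open>The excess \<open>card A + 1 - card V\<close> of a glued set is the sum of the excesses
  of \<open>A1\<close> and \<open>A2\<close> and of \<open>card X - 1\<close>. Summing over the
  nonempty \<open>X\<close> turns the last term into a \<open>q\<close>-integer.\<close>

lemma conn_enum_rec:
  assumes V: "finite V" and r: "r \<in> V" and v: "v \<in> V - {r}"
  shows "conn_enum q V = (\<Sum>B | v \<in> B \<and> B \<subseteq> V - {r}.
    qint q (card {b \<in> B. {r, b} \<in> E}) * conn_enum q B * conn_enum q (V - B))"
proof -
  let ?I = "{B. v \<in> B \<and> B \<subseteq> V - {r}}"
  have fin: "finite ?I"
    using V by (intro finite_subset[of ?I "Pow V"]) auto
  have finB: "finite B" if "B \<in> ?I" for B
    using that V by (auto intro: finite_subset[of B V])
  let ?D = "SIGMA B:?I. (Pow (star r B) - {{}}) \<times> conn_subs B \<times> conn_subs (V - B)"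
  let ?g = "\<lambda>A V. (q - 1) ^ (card A + 1 - card V)"
  have "conn_enum q V = (\<Sum>(B, X, A1, A2)\<in>?D. ?g (X \<union> A1 \<union> A2) V)"
    unfolding conn_enum_def
    by (subst sum.reindex_bij_betw[OF bij_betw_conn_subs[OF r v], symmetric])
      (simp add: case_prod_unfold)
  also have "\<dots> = (\<Sum>(B, X, A1, A2)\<in>?D. (q - 1) ^ (card X - 1) * ?g A1 B * ?g A2 (V - B))"
  proof (intro sum.cong refl)
    fix x assume x: "x \<in> ?D"
    obtain B X A1 A2 where x': "x = (B, X, A1, A2)"
      by (cases x) auto
    have B: "B \<in> ?I" "X \<subseteq> star r B" "X \<noteq> {}" "A1 \<in> conn_subs B" "A2 \<in> conn_subs (V - B)"
      using x by (auto simp: x')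
    have "card (X \<union> A1 \<union> A2) = card X + card A1 + card A2"
      using B V by (intro conn_subs_glue_card) auto
    moreover have "card B \<le> card A1 + 1" "card (V - B) \<le> card A2 + 1"
      using conn_subs_card[OF finB[OF B(1)] B(4)] conn_subs_card[OF _ B(5)] V by auto
    moreover have "card V = card B + card (V - B)"
      using B V by (intro card_split) auto
    moreover have "card X > 0"
      using B finB finite_subset[OF B(2)] by (simp add: card_gt_0_iff)
    ultimately have "card (X \<union> A1 \<union> A2) + 1 - card V
      = (card X - 1) + (card A1 + 1 - card B) + (card A2 + 1 - card (V - B))"
      by linarith
    then show "(case x of (B, X, A1, A2) \<Rightarrow> ?g (X \<union> A1 \<union> A2) V)
      = (case x of (B, X, A1, A2) \<Rightarrow> (q - 1) ^ (card X - 1) * ?g A1 B * ?g A2 (V - B))"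
      by (simp only: x' prod.case power_add)
  qed
  also have "\<dots> = (\<Sum>B\<in>?I. (\<Sum>X\<in>Pow (star r B) - {{}}. (q - 1) ^ (card X - 1) * conn_enum q B)
      * conn_enum q (V - B))"
    unfolding conn_enum_def using fin finB V by (intro sum_Sigma_prod3) auto
  also have "\<dots> = (\<Sum>B\<in>?I. qint q (card {b \<in> B. {r, b} \<in> E}) * conn_enum q B * conn_enum q (V - B))"
    using finB sum_nonempty_subsets[of "star r _" "q - 1"] by (intro sum.cong refl)
      (simp add: sum_distrib_right[symmetric] card_star)
  finally show ?thesis .
qed

section \<open>Trees\<close>

text \<open>Trees as connected edge sets of the least possible size. The edge count passes to the
  parts of a split, so that no cycles have to be considered; \<open>spanning_trees_eq_trees\<close>
  links this to acyclicity.\<close>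

definition trees :: "'a set \<Rightarrow> 'a set set set" where
  "trees V = {T \<in> conn_subs V. card T + 1 = card V}"

lemma trees_singleton: "trees {r} = {{}}"
  by (auto simp: trees_def conn_subs_singleton)

text \<open>The restriction of \<open>bij_betw_conn_subs\<close> to sets of least size: both parts
  meet the bound of \<open>conn_subs_card\<close> with equality, and a single edge joins
  \<open>r\<close> to \<open>B\<close>.\<close>

lemma bij_betw_trees:
  assumes V: "finite V" and r: "r \<in> V" and v: "v \<in> V - {r}"
  shows "bij_betw (\<lambda>(B, c, T1, T2). insert {r, c} (T1 \<union> T2))
    (SIGMA B:{B. v \<in> B \<and> B \<subseteq> V - {r}}. {c \<in> B. {r, c} \<in> E} \<times> trees B \<times> trees (V - B))
    (trees V)" (is "bij_betw ?f ?D _")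
proof (rule bij_betw_imageI)
  let ?D' = "SIGMA B:{B. v \<in> B \<and> B \<subseteq> V - {r}}.
    (Pow (star r B) - {{}}) \<times> conn_subs B \<times> conn_subs (V - B)"
  let ?f' = "\<lambda>(B, X, A1, A2). X \<union> A1 \<union> A2"
  \<comment> \<open>\<open>g\<close> rewrites the joining edge as a singleton \<open>X\<close>, so
    that injectivity and connectedness are inherited from the bijection for connected edge
    sets.\<close>
  define g where "g = (\<lambda>(B :: 'a set, c, T1 :: 'a set set, T2 :: 'a set set). (B, {{r, c}}, T1, T2))"
  have g: "?f x = ?f' (g x)" for x
    by (auto simp: g_def split: prod.splits)
  have gD: "g x \<in> ?D'" if "x \<in> ?D" for x
    using that by (auto simp: g_def trees_def star_def)
  have inj: "inj_on ?f' ?D'" and img: "?f' ` ?D' = conn_subs V"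
    using bij_betw_conn_subs[OF r v] by (auto simp: bij_betw_def)
  show "inj_on ?f ?D"
  proof (rule inj_onI)
    fix x y assume x: "x \<in> ?D" and y: "y \<in> ?D" and "?f x = ?f y"
    then have "g x = g y"
      unfolding g by (intro inj_onD[OF inj] gD) auto
    then show "x = y"
      by (auto simp: g_def doubleton_eq_iff split: prod.splits)
  qed
  have finB: "finite B" if "B \<subseteq> V - {r}" for B
    using that V by (auto intro: finite_subset[of B V])
  have crd: "card (X \<union> A1 \<union> A2) = card X + card A1 + card A2" "card V = card B + card (V - B)"
    if "(B, X, A1, A2) \<in> ?D'" for B X A1 A2
    using that V conn_subs_glue_card[of V B r X A1 A2] card_split[of V B] by auto
  show "?f ` ?D = trees V"
  proof (intro equalityI subsetI)
    fix T assume "T \<in> ?f ` ?D"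
    then obtain x where x: "x \<in> ?D" "T = ?f x"
      by blast
    obtain B c T1 T2 where x': "x = (B, c, T1, T2)"
      by (cases x) auto
    have "T \<in> conn_subs V"
      unfolding img[symmetric] x(2) g by (rule imageI) (rule gD[OF x(1)])
    moreover have "card T = 1 + card T1 + card T2" "card V = card B + card (V - B)"
      using crd[of B "{{r, c}}" T1 T2] gD[OF x(1)] by (simp_all add: x' x(2) g_def)
    ultimately show "T \<in> trees V"
      using x(1) by (simp add: trees_def x')
  next
    fix T assume T: "T \<in> trees V"
    then have "T \<in> ?f' ` ?D'"
      using img by (auto simp: trees_def)
    then obtain B X A1 A2 where D: "(B, X, A1, A2) \<in> ?D'" and TX: "T = X \<union> A1 \<union> A2"
      by auto
    have "card B \<le> card A1 + 1" "card (V - B) \<le> card A2 + 1"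
      using D V finB[of B] conn_subs_card[of B A1] conn_subs_card[of "V - B" A2] by auto
    moreover have "finite X"
      using D finB[of B] finite_subset[of X "star r B"] by auto
    then have "card X > 0"
      using D by (auto simp: card_gt_0_iff)
    ultimately have "card X = 1" "card A1 + 1 = card B" "card A2 + 1 = card (V - B)"
      using T crd[OF D] by (auto simp: trees_def TX)
    moreover from this obtain e where "X = {e}"
      by (auto simp: card_1_singleton_iff)
    moreover from this obtain c where "c \<in> B" "e = {r, c}" "e \<in> E"
      using D by (auto simp: star_def)
    ultimately have "(B, c, A1, A2) \<in> ?D" "T = ?f (B, c, A1, A2)"
      using D TX by (auto simp: trees_def)
    then show "T \<in> ?f ` ?D"
      by blast
  qed
qed

lemma finite_trees [simp]: "finite V \<Longrightarrow> finite (trees V)"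
  by (simp add: trees_def)

lemma sum_trees_rec:
  fixes w :: "'a set set \<Rightarrow> 'r::comm_semiring_1"
  assumes V: "finite V" and r: "r \<in> V" and v: "v \<in> V - {r}"
    and w: "\<And>B c T1 T2. v \<in> B \<Longrightarrow> B \<subseteq> V - {r} \<Longrightarrow> c \<in> B \<Longrightarrow> {r, c} \<in> E \<Longrightarrow> T1 \<in> trees B \<Longrightarrow>
      T2 \<in> trees (V - B) \<Longrightarrow> w (insert {r, c} (T1 \<union> T2)) = f B c * g B c T1 * h B T2"
  shows "(\<Sum>T\<in>trees V. w T) = (\<Sum>B | v \<in> B \<and> B \<subseteq> V - {r}.
    (\<Sum>c | c \<in> B \<and> {r, c} \<in> E. f B c * (\<Sum>T\<in>trees B. g B c T)) * (\<Sum>T\<in>trees (V - B). h B T))"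
proof -
  let ?I = "{B. v \<in> B \<and> B \<subseteq> V - {r}}"
  have fin: "finite ?I"
    using V by (intro finite_subset[of ?I "Pow V"]) auto
  have finB: "finite B" if "B \<in> ?I" for B
    using that V by (auto intro: finite_subset[of B V])
  let ?D = "SIGMA B:?I. {c \<in> B. {r, c} \<in> E} \<times> trees B \<times> trees (V - B)"
  have "(\<Sum>T\<in>trees V. w T) = (\<Sum>(B, c, T1, T2)\<in>?D. w (insert {r, c} (T1 \<union> T2)))"
    by (subst sum.reindex_bij_betw[OF bij_betw_trees[OF V r v], symmetric])
      (simp add: case_prod_unfold)
  also have "\<dots> = (\<Sum>(B, c, T1, T2)\<in>?D. f B c * g B c T1 * h B T2)"
    by (intro sum.cong refl) (auto intro!: w)
  also have "\<dots> = (\<Sum>B\<in>?I. (\<Sum>c\<in>{c \<in> B. {r, c} \<in> E}. f B c * (\<Sum>T\<in>trees B. g B c T))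
      * (\<Sum>T\<in>trees (V - B). h B T))"
    using fin finB V by (intro sum_Sigma_prod3) auto
  finally show ?thesis
    by simp
qed

end

section \<open>Paths and descendants\<close>

lemma simple_path_singleton [simp]: "simple_path T [x]"
  by (simp add: simple_path_def)

lemma simple_path_Nil [simp]: "\<not> simple_path T []"
  by (simp add: simple_path_def)

lemma simple_path_Cons_Cons [simp]:
  "simple_path T (x # y # p) \<longleftrightarrow> {x, y} \<in> T \<and> x \<notin> set (y # p) \<and> simple_path T (y # p)"
proof -
  have "(\<forall>k. Suc k < length (x # y # p) \<longrightarrow> {(x # y # p) ! k, (x # y # p) ! Suc k} \<in> T) \<longleftrightarrow>
    {x, y} \<in> T \<and> (\<forall>k. Suc k < length (y # p) \<longrightarrow> {(y # p) ! k, (y # p) ! Suc k} \<in> T)"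
    (is "(\<forall>k. ?P k) \<longleftrightarrow> _ \<and> (\<forall>k. ?Q k)")
  proof -
    have "(\<forall>k. ?P k) \<longleftrightarrow> ?P 0 \<and> (\<forall>k. ?P (Suc k))"
      by (metis not0_implies_Suc)
    then show ?thesis
      by simp
  qed
  then show ?thesis
    unfolding simple_path_def by auto
qed

lemma simple_path_mono: "simple_path T p \<Longrightarrow> T \<subseteq> T' \<Longrightarrow> simple_path T' p"
  by (auto simp: simple_path_def)

lemma simple_path_append1: "simple_path T (p @ q) \<Longrightarrow> p \<noteq> [] \<Longrightarrow> simple_path T p"
  by (induction p rule: induct_list012) auto

lemma simple_path_snoc:
  assumes "simple_path T p" "{last p, x} \<in> T" "x \<notin> set p"
  shows "simple_path T (p @ [x])"
  using assms
proof (induction p rule: induct_list012)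
  case (3 y z p)
  then show ?case
    by (auto split: if_splits)
qed auto

lemma simple_path_subset:
  assumes "simple_path T p" "T \<subseteq> Pow V" "hd p \<in> V"
  shows "set p \<subseteq> V"
  using assms
proof (induction p rule: induct_list012)
  case (3 y z p)
  then have "{y, z} \<subseteq> V"
    by auto
  then show ?case
    using 3 by auto
qed auto

text \<open>The vertices reached by simple paths from \<open>a\<close> form all of \<open>V\<close>:
  an edge leaving this set would prolong a path, or end on the path, which could then be cut short
  there.\<close>

lemma conn_simple_path:
  assumes V: "conn V A" and a: "a \<in> V" and b: "b \<in> V"
  shows "\<exists>p. simple_path A p \<and> hd p = a \<and> last p = b"
proof -
  define S where "S = {x \<in> V. \<exists>p. simple_path A p \<and> hd p = a \<and> last p = x}"
  have "a \<in> S"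
    using a by (auto simp: S_def intro!: exI[of _ "[a]"])
  have "S = V"
  proof (rule ccontr)
    assume "S \<noteq> V"
    moreover have "S \<subseteq> V" "S \<noteq> {}"
      using \<open>a \<in> S\<close> by (auto simp: S_def)
    ultimately obtain x y where x: "x \<in> S" and y: "y \<in> V - S" and xy: "{x, y} \<in> A"
      using conn_cut[OF V] by metis
    obtain p where p: "simple_path A p" "hd p = a" "last p = x"
      using x by (auto simp: S_def)
    have "p \<noteq> []"
      using p by auto
    show False
    proof (cases "y \<in> set p")
      case True
      then obtain p1 p2 where "p = p1 @ y # p2"
        by (auto simp: in_set_conv_decomp)
      then have "simple_path A (p1 @ [y])" "hd (p1 @ [y]) = a"
        using p simple_path_append1[of A "p1 @ [y]" p2] by (auto simp: hd_append)
      then show False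
        using y unfolding S_def by (metis (mono_tags, lifting) DiffD1 DiffD2 last_snoc mem_Collect_eq)
    next
      case False
      then have "simple_path A (p @ [y])" "hd (p @ [y]) = a"
        using p xy simple_path_snoc[of A p y] \<open>p \<noteq> []\<close> by auto
      then show False
        using y unfolding S_def by (metis (mono_tags, lifting) DiffD1 DiffD2 last_snoc mem_Collect_eq)
    qed
  qed
  then show ?thesis
    using b by (auto simp: S_def)
qed

definition dsc :: "'a set set \<Rightarrow> 'a \<Rightarrow> 'a \<Rightarrow> 'a \<Rightarrow> bool" where
  "dsc T r i j \<longleftrightarrow> i \<noteq> j \<and> (\<exists>p. simple_path T p \<and> hd p = r \<and> last p = j \<and> i \<in> set p)"

lemma dsc_mem:
  assumes "dsc T r i j" "T \<subseteq> Pow V" "r \<in> V"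
  shows "i \<in> V" "j \<in> V"
proof -
  obtain p where p: "simple_path T p" "hd p = r" "last p = j" "i \<in> set p"
    using assms by (auto simp: dsc_def)
  then have "set p \<subseteq> V" "j \<in> set p"
    using simple_path_subset[of T p V] assms(2,3) by (auto intro!: last_in_set)
  then show "i \<in> V" "j \<in> V"
    using p by auto
qed

lemma dsc_root:
  assumes "conn V T" "T \<subseteq> Pow V" "r \<in> V"
  shows "dsc T r r j \<longleftrightarrow> j \<in> V - {r}"
proof
  assume "dsc T r r j"
  then show "j \<in> V - {r}"
    using dsc_mem[OF _ assms(2,3)] by (auto simp: dsc_def)
next
  assume j: "j \<in> V - {r}"
  then obtain p where p: "simple_path T p" "hd p = r" "last p = j"
    using conn_simple_path[OF assms(1,3)] by blast
  then have "r \<in> set p"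
    by (metis hd_in_set simple_path_Nil)
  then show "dsc T r r j"
    using p j by (auto simp: dsc_def)
qed

text \<open>The branch \<open>T1\<close> hangs from \<open>r\<close> by the edge
  \<open>{r, c}\<close> and has the root \<open>c\<close>; the remainder \<open>T2\<close> keeps the
  root \<open>r\<close>.\<close>

locale glued_tree =
  fixes V B :: "'a set" and r c :: 'a and T1 T2 :: "'a set set"
  assumes r: "r \<in> V" and B: "B \<subseteq> V - {r}" and c: "c \<in> B"
    and T1: "T1 \<subseteq> Pow B" "conn B T1" and T2: "T2 \<subseteq> Pow (V - B)" "conn (V - B) T2"
begin

abbreviation T where "T \<equiv> insert {r, c} (T1 \<union> T2)"

lemma rB: "r \<in> V - B"
  using r B by auto

lemma path_in_branch:
  "simple_path T p \<Longrightarrow> hd p \<in> B \<Longrightarrow> r \<notin> set p \<Longrightarrow> simple_path T1 p"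
proof (induction p rule: induct_list012)
  case (3 x y p)
  then have "{x, y} \<in> T1"
    using T2 by (auto simp: doubleton_eq_iff)
  then show ?case
    using 3 T1 by auto
qed auto

lemma path_off_branch:
  "simple_path T p \<Longrightarrow> hd p \<in> V - B \<Longrightarrow> r \<notin> set p \<Longrightarrow> simple_path T2 p"
proof (induction p rule: induct_list012)
  case (3 x y p)
  then have "{x, y} \<in> T2"
    using T1 by (auto simp: doubleton_eq_iff)
  then show ?case
    using 3 T2 by auto
qed auto

text \<open>A path from \<open>r\<close> either stays in \<open>T2\<close> or enters the branch with
  its first step; in the second case it cannot come back, since the only way out passes through
  \<open>r\<close>.\<close>

lemma path_from_root:
  "simple_path T p \<and> hd p = r \<longleftrightarrow>
    simple_path T2 p \<and> hd p = r \<or> (\<exists>p'. p = r # p' \<and> simple_path T1 p' \<and> hd p' = c)"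
proof (intro iffI; (elim disjE exE conjE)?)
  assume p: "simple_path T p" "hd p = r"
  then obtain p' where p': "p = r # p'"
    by (cases p) auto
  show "simple_path T2 p \<and> hd p = r \<or> (\<exists>p'. p = r # p' \<and> simple_path T1 p' \<and> hd p' = c)"
  proof (cases p')
    case (Cons x p'')
    then have x: "{r, x} \<in> T" "r \<notin> set p'" "simple_path T p'"
      using p p' by auto
    show ?thesis
    proof (cases "x = c")
      case True
      then show ?thesis
        using path_in_branch[of p'] x c p' Cons by auto
    next
      case False
      then have "{r, x} \<in> T2"
        using x T1 rB by (auto simp: doubleton_eq_iff)
      moreover have "simple_path T2 p'"
        using path_off_branch[of p'] x T2 calculation Cons by auto
      ultimately show ?thesis
        using p' Cons x by auto
    qed
  qed (use p' in auto)
next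
  assume "simple_path T2 p" "hd p = r"
  then show "simple_path T p \<and> hd p = r"
    by (auto elim: simple_path_mono)
next
  fix p' assume p: "p = r # p'" "simple_path T1 p'" "hd p' = c"
  then have "simple_path T p'" "set p' \<subseteq> B"
    using simple_path_subset[of T1 p' B] T1 c by (auto elim: simple_path_mono)
  then show "simple_path T p \<and> hd p = r"
    using p rB by (cases p') auto
qed

text \<open>Paths into the branch are paths from \<open>c\<close> preceded by \<open>r\<close>. Thus
  \<open>r\<close> is an ancestor of all of \<open>B\<close>, and every other ancestor is one within
  its own part.\<close>

lemma dsc_iff: "dsc T r i j \<longleftrightarrow> dsc T2 r i j \<or> i = r \<and> j \<in> B \<or> dsc T1 c i j"
proof -
  have "(\<exists>p. simple_path T p \<and> hd p = r \<and> last p = j \<and> i \<in> set p) \<longleftrightarrow>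
    (\<exists>p. simple_path T2 p \<and> hd p = r \<and> last p = j \<and> i \<in> set p) \<or>
    (\<exists>p. simple_path T1 p \<and> hd p = c \<and> last p = j \<and> (i = r \<or> i \<in> set p))"
    (is "?L \<longleftrightarrow> ?R1 \<or> ?R2")
  proof -
    have "?L \<longleftrightarrow> (\<exists>p. (simple_path T2 p \<and> hd p = r \<or>
      (\<exists>p'. p = r # p' \<and> simple_path T1 p' \<and> hd p' = c)) \<and> last p = j \<and> i \<in> set p)"
      using path_from_root by blast
    also have "\<dots> \<longleftrightarrow> ?R1 \<or> (\<exists>p'. simple_path T1 p' \<and> hd p' = c \<and> last (r # p') = j \<and> i \<in> set (r # p'))"
      by blast
    also have "(\<exists>p'. simple_path T1 p' \<and> hd p' = c \<and> last (r # p') = j \<and> i \<in> set (r # p')) \<longleftrightarrow> ?R2"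
      by (intro ex_cong1) auto
    finally show ?thesis .
  qed
  moreover have "(\<exists>p. simple_path T1 p \<and> hd p = c \<and> last p = j) \<longleftrightarrow> j \<in> B"
  proof
    assume "\<exists>p. simple_path T1 p \<and> hd p = c \<and> last p = j"
    then obtain p where "simple_path T1 p" "hd p = c" "last p = j"
      by blast
    then show "j \<in> B"
      using simple_path_subset[of T1 p B] T1 c by (cases "p = []") auto
  qed (use conn_simple_path[OF T1(2) c] in blast)
  moreover have "r \<notin> B"
    using rB by auto
  ultimately show ?thesis
    unfolding dsc_def by blast
qed

lemma dsc_branch_iff:
  assumes "i \<in> B"
  shows "dsc T r i j \<longleftrightarrow> dsc T1 c i j"
  using assms dsc_iff[of i j] dsc_mem(1)[OF _ T2(1) rB, of i j] rB by auto

lemma dsc_off_branch_iff: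
  assumes "i \<in> V - B - {r}"
  shows "dsc T r i j \<longleftrightarrow> dsc T2 r i j"
  using assms dsc_iff[of i j] dsc_mem(1)[OF _ T1(1) c, of i j] by auto

end

lemma (in simple_graph) glued_treeI:
  assumes "r \<in> V" "B \<subseteq> V - {r}" "c \<in> B" "T1 \<in> trees B" "T2 \<in> trees (V - B)"
  shows "glued_tree V B r c T1 T2"
  using assms by unfold_locales (auto simp: trees_def conn_subs_def)

section \<open>Inversions\<close>

text \<open>The root is excluded because the root \<open>c\<close> of a branch may exceed some of
  its descendants; those pairs are counted only when the branch is glued to the rest.\<close>

definition rooted_inversions :: "nat \<Rightarrow> nat set set \<Rightarrow> (nat \<times> nat) set" where
  "rooted_inversions r T = {(i, j). i \<noteq> r \<and> j < i \<and> dsc T r i j}"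

lemma rooted_inversions_subset:
  assumes "T \<subseteq> Pow V" "r \<in> V"
  shows "rooted_inversions r T \<subseteq> V \<times> V"
  using dsc_mem[OF _ assms] by (auto simp: rooted_inversions_def)

text \<open>In the branch alone, \<open>c\<close> is the root and never the larger element of an
  inversion. After gluing it forms inversions with every smaller vertex of \<open>B\<close>; all
  other inversions come from one of the two parts.\<close>

lemma card_rooted_inversions_glue:
  fixes V :: "nat set"
  assumes "glued_tree V B r c T1 T2" and V: "finite V"
  shows "card (rooted_inversions r (insert {r, c} (T1 \<union> T2)))
    = card {j \<in> B. j < c} + card (rooted_inversions c T1) + card (rooted_inversions r T2)"
proof -
  interpret glued_tree V B r c T1 T2
    by fact
  have sub1: "rooted_inversions c T1 \<subseteq> B \<times> B" and sub2: "rooted_inversions r T2 \<subseteq> (V - B) \<times> (V - B)"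
    using rooted_inversions_subset T1 T2 c rB by metis+
  have fin: "finite B" "finite (V - B)"
    using B V finite_subset[of B V] by auto
  have fin12: "finite (rooted_inversions c T1)" "finite (rooted_inversions r T2)"
    using finite_subset[OF sub1] finite_subset[OF sub2] fin by auto
  let ?J = "Pair c ` {j \<in> B. j < c}"
  have J: "card ?J = card {j \<in> B. j < c}"
    by (rule card_image) (auto simp: inj_on_def)
  have "dsc T1 c c j \<longleftrightarrow> j \<in> B - {c}" for j
    using dsc_root[OF T1(2,1) c] .
  then have "rooted_inversions r T = ?J \<union> rooted_inversions c T1 \<union> rooted_inversions r T2"
    using c rB dsc_mem[OF _ T1(1) c] by (auto simp: rooted_inversions_def dsc_iff)
  moreover have "?J \<inter> rooted_inversions c T1 = {}"
    by (auto simp: rooted_inversions_def)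
  moreover have "(?J \<union> rooted_inversions c T1) \<inter> rooted_inversions r T2 = {}"
    using sub1 sub2 c by auto
  ultimately show ?thesis
    using fin fin12 J by (simp add: card_Un_disjoint)
qed

text \<open>The elements of \<open>S\<close> have the ranks \<open>0, ..., card S - 1\<close>, each
  once.\<close>

lemma sum_power_rank:
  fixes q :: "'r::comm_semiring_1" and S :: "nat set"
  assumes "finite S"
  shows "(\<Sum>c\<in>S. q ^ card {j \<in> S. j < c}) = qint q (card S)"
  using assms
proof (induction S rule: finite_linorder_max_induct)
  case (insert m S)
  have "{j \<in> insert m S. j < c} = {j \<in> S. j < c}" if "c \<in> S" for c
    using insert that by auto
  moreover have "{j \<in> insert m S. j < m} = S"
    using insert by auto
  moreover have "m \<notin> S"
    using insert by auto
  ultimately show ?case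
    using insert by (simp add: add.commute)
qed simp

locale nat_graph = simple_graph E for E :: "nat set set"

text \<open>The form in which the threshold property is used. The condition
  \<open>i \<noteq> k\<close> keeps the new edge from degenerating to a loop.\<close>

locale shifted_graph = nat_graph +
  assumes shifted: "{j, k} \<in> E \<Longrightarrow> i < j \<Longrightarrow> i \<noteq> k \<Longrightarrow> {i, k} \<in> E"
begin

text \<open>The root is arbitrary for the sake of the induction: the branch split off at
  \<open>r\<close> is rooted at its attaching vertex \<open>c\<close>.\<close>

lemma sum_trees_inversions:
  fixes q :: "'r::comm_ring_1"
  assumes "finite V" "r \<in> V"
  shows "(\<Sum>T\<in>trees V. q ^ card (rooted_inversions r T)) = conn_enum q V"
  using assms
proof (induction "card V" arbitrary: V r rule: less_induct)
  case less
  show ?case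
  proof (cases "V = {r}")
    case True
    have "rooted_inversions r {} = {}"
      using rooted_inversions_subset[of "{}" "{r}" r] by (auto simp: rooted_inversions_def)
    then show ?thesis
      by (simp add: True trees_singleton)
  next
    case False
    then obtain v where v: "v \<in> V - {r}"
      using less.prems by blast
    have IH: "(\<Sum>T\<in>trees B. q ^ card (rooted_inversions c T)) = conn_enum q B"
      if "B \<subset> V" "c \<in> B" for B c
      using less.hyps[OF psubset_card_mono[OF less.prems(1) that(1)] _ that(2)] that less.prems(1)
      by (meson finite_subset psubset_imp_subset)
    have "(\<Sum>T\<in>trees V. q ^ card (rooted_inversions r T)) = (\<Sum>B | v \<in> B \<and> B \<subseteq> V - {r}.
      (\<Sum>c | c \<in> B \<and> {r, c} \<in> E. q ^ card {j \<in> B. j < c}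
          * (\<Sum>T\<in>trees B. q ^ card (rooted_inversions c T)))
        * (\<Sum>T\<in>trees (V - B). q ^ card (rooted_inversions r T)))"
    proof (intro sum_trees_rec less.prems v)
      fix B c T1 T2
      assume "B \<subseteq> V - {r}" "c \<in> B" "T1 \<in> trees B" "T2 \<in> trees (V - B)"
      then have "glued_tree V B r c T1 T2"
        by (intro glued_treeI less.prems)
      from card_rooted_inversions_glue[OF this less.prems(1)]
      show "q ^ card (rooted_inversions r (insert {r, c} (T1 \<union> T2)))
        = q ^ card {j \<in> B. j < c} * q ^ card (rooted_inversions c T1) * q ^ card (rooted_inversions r T2)"
        by (simp add: power_add)
    qed
    also have "\<dots> = (\<Sum>B | v \<in> B \<and> B \<subseteq> V - {r}.
      qint q (card {b \<in> B. {r, b} \<in> E}) * conn_enum q B * conn_enum q (V - B))"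
    proof (intro sum.cong refl)
      fix B assume "B \<in> {B. v \<in> B \<and> B \<subseteq> V - {r}}"
      then have B: "B \<subset> V" "V - B \<subset> V" "r \<in> V - B" "r \<notin> B"
        using less.prems(2) by auto
      have fin: "finite B"
        using B less.prems(1) by (meson finite_subset psubset_imp_subset)
      let ?N = "{b \<in> B. {r, b} \<in> E}"
      \<comment> \<open>A vertex of \<open>B\<close> below a neighbour \<open>c\<close> of
        \<open>r\<close> is a neighbour of \<open>r\<close> by shiftedness, so the rank of
        \<open>c\<close> in \<open>B\<close> is its rank among the neighbours.\<close>
      have "{j \<in> B. j < c} = {j \<in> ?N. j < c}" if "c \<in> ?N" for c
        using that shifted[of c r] B by (auto simp: insert_commute)
      then have "(\<Sum>c\<in>?N. q ^ card {j \<in> B. j < c}) = (\<Sum>c\<in>?N. q ^ card {j \<in> ?N. j < c})"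
        by (intro sum.cong refl) (simp only:)
      also have "\<dots> = qint q (card ?N)"
        using fin by (intro sum_power_rank) simp
      finally have "(\<Sum>c\<in>?N. q ^ card {j \<in> B. j < c}) = qint q (card ?N)" .
      then show "(\<Sum>c | c \<in> B \<and> {r, c} \<in> E. q ^ card {j \<in> B. j < c}
          * (\<Sum>T\<in>trees B. q ^ card (rooted_inversions c T)))
        * (\<Sum>T\<in>trees (V - B). q ^ card (rooted_inversions r T))
        = qint q (card ?N) * conn_enum q B * conn_enum q (V - B)"
        using IH[OF B(1)] IH[OF B(2,3)] by (simp add: sum_distrib_right[symmetric])
    qed
    also have "\<dots> = conn_enum q V"
      by (rule conn_enum_rec[OF less.prems v, symmetric])
    finally show ?thesis .
  qed
qed

end

section \<open>Parking functions relative to a burned set\<close>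

text \<open>
  In the burning algorithm \<open>R\<close> is the set of burned vertices and \<open>W\<close> the set of unburned ones;
  edges between burned vertices have already been discarded from \<open>F\<close>.
\<close>

definition rpark :: "'a set \<Rightarrow> 'a set \<Rightarrow> 'a set set \<Rightarrow> ('a \<Rightarrow> nat) set" where
  "rpark R W F =
     {P \<in> W \<rightarrow>\<^sub>E UNIV. \<forall>S\<subseteq>W. S \<noteq> {} \<longrightarrow> (\<exists>i\<in>S. P i < card {j \<in> R \<union> W - S. {i, j} \<in> F})}"

text \<open>For nonempty \<open>R\<close>, connectedness after contracting \<open>R\<close> to one
  vertex, in the form of \<open>conn_root\<close>.\<close>

definition rconn :: "'a set \<Rightarrow> 'a set \<Rightarrow> 'a set set \<Rightarrow> bool" where
  "rconn R W A \<longleftrightarrow> (\<forall>S\<subseteq>W. S \<noteq> {} \<longrightarrow> (\<exists>i\<in>S. \<exists>j\<in>R \<union> W - S. {i, j} \<in> A))"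

lemma all_subsets_remove:
  assumes "\<And>S. S \<subseteq> W - {v} \<Longrightarrow> Q' S \<longleftrightarrow> Q S" "\<And>S. v \<in> S \<Longrightarrow> S \<subseteq> W \<Longrightarrow> Q S"
  shows "(\<forall>S\<subseteq>W. S \<noteq> {} \<longrightarrow> Q S) \<longleftrightarrow> (\<forall>S\<subseteq>W - {v}. S \<noteq> {} \<longrightarrow> Q' S)"
proof -
  have "S \<subseteq> W - {v} \<longleftrightarrow> S \<subseteq> W \<and> v \<notin> S" for S
    by auto
  then show ?thesis
    using assms by (intro iffI allI impI) (simp, metis)
qed

text \<open>A vertex \<open>i\<close> of \<open>S\<close> with \<open>P i\<close> below its number
  of edges out of \<open>S\<close> can be removed: those edges do not meet \<open>S - {i}\<close>,
  and there are at least \<open>P i + 1\<close> of them. The bound makes the exponent in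
  \<open>park_enum\<close> exact.\<close>

lemma rpark_bound:
  assumes fin: "finite W" "finite F" and P: "P \<in> rpark R W F"
  shows "card W + (\<Sum>i\<in>W. P i) \<le> card F"
proof -
  have main: "(\<Sum>i\<in>S. P i + 1) \<le> card {e \<in> F. e \<inter> S \<noteq> {}}" if "finite S" "S \<subseteq> W" for S
    using that
  proof (induction S rule: finite_psubset_induct)
    case (psubset S)
    show ?case
    proof (cases "S = {}")
      case False
      then obtain i where i: "i \<in> S" and less: "P i < card {j \<in> R \<union> W - S. {i, j} \<in> F}"
        using P psubset.prems unfolding rpark_def by blast
      let ?J = "{j \<in> R \<union> W - S. {i, j} \<in> F}"
      let ?A = "{e \<in> F. e \<inter> (S - {i}) \<noteq> {}}"
      have "(\<Sum>k\<in>S - {i}. P k + 1) \<le> card ?A"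
        using psubset.prems i by (intro psubset.IH) auto
      moreover have "card ((\<lambda>j. {i, j}) ` ?J) = card ?J"
        by (rule card_image) (auto simp: inj_on_def doubleton_eq_iff)
      moreover have "finite ((\<lambda>j. {i, j}) ` ?J)"
        using fin(2) by (rule rev_finite_subset) auto
      then have "card (?A \<union> (\<lambda>j. {i, j}) ` ?J) = card ?A + card ((\<lambda>j. {i, j}) ` ?J)"
        using fin by (intro card_Un_disjoint) auto
      moreover have "card (?A \<union> (\<lambda>j. {i, j}) ` ?J) \<le> card {e \<in> F. e \<inter> S \<noteq> {}}"
        using fin i by (intro card_mono) auto
      moreover have "(\<Sum>k\<in>S. P k + 1) = (P i + 1) + (\<Sum>k\<in>S - {i}. P k + 1)"
        using psubset.hyps i by (rule sum.remove)
      ultimately show ?thesis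
        using less by linarith
    qed simp
  qed
  have "(\<Sum>i\<in>W. P i + 1) \<le> card {e \<in> F. e \<inter> W \<noteq> {}}"
    using fin by (intro main) auto
  also have "\<dots> \<le> card F"
    using fin by (intro card_mono) auto
  finally show ?thesis
    by (simp only: sum.distrib) simp
qed

text \<open>If \<open>A\<close> is connected relative to \<open>R\<close>, the zero function is a
  parking function of \<open>A\<close>, so \<open>rpark_bound\<close> applies.\<close>

lemma rconn_bound:
  assumes fin: "finite R" "finite W" "finite A" and A: "rconn R W A"
  shows "card W \<le> card A"
proof -
  have "\<exists>i\<in>S. (\<lambda>i\<in>W. 0::nat) i < card {j \<in> R \<union> W - S. {i, j} \<in> A}" if S: "S \<subseteq> W" "S \<noteq> {}" for S
  proof -
    obtain i j where "i \<in> S" "j \<in> R \<union> W - S" "{i, j} \<in> A"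
      using A S unfolding rconn_def by blast
    moreover from this have "card {j \<in> R \<union> W - S. {i, j} \<in> A} > 0"
      using fin by (auto simp: card_gt_0_iff)
    ultimately show ?thesis
      using S(1) by (intro bexI[of _ i]) auto
  qed
  then have "(\<lambda>i\<in>W. 0) \<in> rpark R W A"
    by (auto simp: rpark_def)
  from rpark_bound[OF fin(2,3) this] show ?thesis
    by simp
qed

lemma finite_rpark:
  assumes "finite W" "finite F"
  shows "finite (rpark R W F)"
proof (rule finite_subset)
  show "rpark R W F \<subseteq> W \<rightarrow>\<^sub>E {..card F}"
  proof
    fix P assume P: "P \<in> rpark R W F"
    have "P i \<le> card F" if "i \<in> W" for i
      using rpark_bound[OF assms P] member_le_sum[of i W P] that assms by auto
    then show "P \<in> W \<rightarrow>\<^sub>E {..card F}"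
      using P by (auto simp: rpark_def PiE_def)
  qed
qed (use assms in \<open>auto intro: finite_PiE\<close>)

section \<open>Deletion and contraction at an unburned vertex\<close>

locale rooted_graph =
  fixes R W :: "'a set" and F :: "'a set set"
  assumes fin: "finite R" "finite W" "finite F" and disj: "R \<inter> W = {}"
    and edge: "e \<in> F \<Longrightarrow> \<exists>a b. a \<noteq> b \<and> e = {a, b}"
    and sub: "e \<in> F \<Longrightarrow> e \<subseteq> R \<union> W" and nsub: "e \<in> F \<Longrightarrow> \<not> e \<subseteq> R"
begin

definition root_edges :: "'a \<Rightarrow> 'a set set" where
  "root_edges v = {e \<in> F. \<exists>j\<in>R. e = {v, j}}"

lemma root_edges_subset: "root_edges v \<subseteq> F"
  by (auto simp: root_edges_def)

lemma finite_root_edges: "finite (root_edges v)"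
  using fin root_edges_subset finite_subset by blast

lemma card_root_edges: "card (root_edges v) = card {j \<in> R. {v, j} \<in> F}"
proof -
  have "root_edges v = (\<lambda>j. {v, j}) ` {j \<in> R. {v, j} \<in> F}"
    by (auto simp: root_edges_def)
  moreover have "inj_on (\<lambda>j. {v, j}) {j \<in> R. {v, j} \<in> F}"
    by (auto simp: inj_on_def doubleton_eq_iff)
  ultimately show ?thesis
    by (simp add: card_image)
qed

lemma root_edges_iff:
  assumes "v \<in> W" "i \<in> W"
  shows "{i, j} \<in> root_edges v \<longleftrightarrow> i = v \<and> j \<in> R \<and> {i, j} \<in> F"
  using assms disj by (auto simp: root_edges_def doubleton_eq_iff)

lemma delete: "rooted_graph R W (F - root_edges v)"
  using fin disj edge sub nsub by unfold_locales auto

lemma contract: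
  assumes v: "v \<in> W"
  shows "rooted_graph (insert v R) (W - {v}) (F - root_edges v)"
proof unfold_locales
  fix e assume e: "e \<in> F - root_edges v"
  show "\<not> e \<subseteq> insert v R"
  proof
    assume *: "e \<subseteq> insert v R"
    obtain a b where "a \<noteq> b" "e = {a, b}"
      using edge e by blast
    moreover have "v \<in> e"
      using nsub e * by auto
    ultimately obtain j where "e = {v, j}" "j \<in> R"
      using * by auto
    then show False
      using e by (auto simp: root_edges_def)
  qed
qed (use fin disj edge sub in auto)

lemma card_delete: "card F = card (root_edges v) + card (F - root_edges v)"
  using fin root_edges_subset[of v] finite_root_edges[of v] card_mono[of F "root_edges v"]
  by (simp add: card_Diff_subset)

lemma contract_complement: "v \<in> W \<Longrightarrow> S \<subseteq> W - {v} \<Longrightarrow> insert v R \<union> (W - {v}) - S = R \<union> W - S"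
  by auto

text \<open>If \<open>P v\<close> is below the number of edges from \<open>v\<close> to
  \<open>R\<close>, then \<open>v\<close> burns at once: every set containing \<open>v\<close> meets
  the condition at \<open>v\<close>. For the other sets, \<open>v\<close> lies outside both before
  and after it joins \<open>R\<close>.\<close>

lemma rpark_contract:
  assumes v: "v \<in> W" and P: "P \<in> W \<rightarrow>\<^sub>E UNIV" and less: "P v < card (root_edges v)"
  shows "P \<in> rpark R W F \<longleftrightarrow> restrict P (W - {v}) \<in> rpark (insert v R) (W - {v}) (F - root_edges v)"
proof -
  have 1: "(\<exists>i\<in>S. restrict P (W - {v}) i
      < card {j \<in> insert v R \<union> (W - {v}) - S. {i, j} \<in> F - root_edges v}) \<longleftrightarrow>
    (\<exists>i\<in>S. P i < card {j \<in> R \<union> W - S. {i, j} \<in> F})" if S: "S \<subseteq> W - {v}" for S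
    unfolding contract_complement[OF v S]
  proof (intro bex_cong refl)
    fix i assume i: "i \<in> S"
    then have "{i, j} \<in> F - root_edges v \<longleftrightarrow> {i, j} \<in> F" for j
      using S root_edges_iff[OF v, of i j] by auto
    then show "restrict P (W - {v}) i < card {j \<in> R \<union> W - S. {i, j} \<in> F - root_edges v} \<longleftrightarrow>
      P i < card {j \<in> R \<union> W - S. {i, j} \<in> F}"
      using i S by auto
  qed
  have 2: "\<exists>i\<in>S. P i < card {j \<in> R \<union> W - S. {i, j} \<in> F}" if S: "v \<in> S" "S \<subseteq> W" for S
  proof -
    have "card {j \<in> R. {v, j} \<in> F} \<le> card {j \<in> R \<union> W - S. {v, j} \<in> F}"
      using S disj fin by (intro card_mono) auto
    then show ?thesis
      using less S unfolding card_root_edges by (meson less_le_trans)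
  qed
  have "restrict P (W - {v}) \<in> (W - {v}) \<rightarrow>\<^sub>E UNIV"
    by auto
  then show ?thesis
    using P all_subsets_remove[of W v, OF 1 2] unfolding rpark_def by simp
qed

text \<open>Deleting the edges from \<open>v\<close> to \<open>R\<close> lowers the number of edges
  out of \<open>S\<close> at \<open>v\<close> by \<open>card (root_edges v)\<close> for every
  \<open>S\<close> containing \<open>v\<close>; lowering \<open>P v\<close> by the same amount keeps
  the comparison. The counts at other vertices do not change.\<close>

lemma rpark_delete:
  assumes v: "v \<in> W" and P: "P \<in> W \<rightarrow>\<^sub>E UNIV" and ge: "card (root_edges v) \<le> P v"
  shows "P \<in> rpark R W F \<longleftrightarrow> P(v := P v - card (root_edges v)) \<in> rpark R W (F - root_edges v)"
proof -
  let ?P = "P(v := P v - card (root_edges v))"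
  have "?P i < card {j \<in> R \<union> W - S. {i, j} \<in> F - root_edges v} \<longleftrightarrow>
      P i < card {j \<in> R \<union> W - S. {i, j} \<in> F}" if S: "S \<subseteq> W" "i \<in> S" for S i
  proof (cases "i = v")
    case True
    have "{j \<in> R \<union> W - S. {v, j} \<in> F}
        = {j \<in> R. {v, j} \<in> F} \<union> {j \<in> R \<union> W - S. {v, j} \<in> F - root_edges v}"
      using S disj by (auto simp: root_edges_iff[OF v v])
    moreover have "{j \<in> R. {v, j} \<in> F} \<inter> {j \<in> R \<union> W - S. {v, j} \<in> F - root_edges v} = {}"
      by (auto simp: root_edges_iff[OF v v])
    ultimately have "card {j \<in> R \<union> W - S. {v, j} \<in> F}
        = card (root_edges v) + card {j \<in> R \<union> W - S. {v, j} \<in> F - root_edges v}"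
      using fin unfolding card_root_edges by (simp add: card_Un_disjoint)
    then show ?thesis
      using True ge by auto
  next
    case False
    then have "{i, j} \<in> F - root_edges v \<longleftrightarrow> {i, j} \<in> F" for j
      using S root_edges_iff[OF v, of i j] by auto
    then show ?thesis
      using False by auto
  qed
  then have "(\<exists>i\<in>S. ?P i < card {j \<in> R \<union> W - S. {i, j} \<in> F - root_edges v}) \<longleftrightarrow>
      (\<exists>i\<in>S. P i < card {j \<in> R \<union> W - S. {i, j} \<in> F})" if "S \<subseteq> W" for S
    using that by (intro bex_cong) auto
  moreover have "?P \<in> W \<rightarrow>\<^sub>E UNIV"
    using P v by (auto simp: PiE_def extensional_def)
  ultimately show ?thesis
    using P unfolding rpark_def by (smt (verit) mem_Collect_eq)
qed

lemma rpark_split: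
  assumes v: "v \<in> W"
  defines "k \<equiv> card (root_edges v)"
  shows "rpark R W F =
    (\<lambda>(a, P). P(v := a)) ` ({..<k} \<times> rpark (insert v R) (W - {v}) (F - root_edges v)) \<union>
    (\<lambda>P. P(v := P v + k)) ` rpark R W (F - root_edges v)" (is "_ = ?C \<union> ?D")
proof (intro equalityI subsetI)
  fix P assume P: "P \<in> rpark R W F"
  then have PE: "P \<in> W \<rightarrow>\<^sub>E UNIV"
    by (simp add: rpark_def)
  show "P \<in> ?C \<union> ?D"
  proof (cases "P v < k")
    case True
    then have "restrict P (W - {v}) \<in> rpark (insert v R) (W - {v}) (F - root_edges v)"
      using rpark_contract[OF v PE] P by (simp add: k_def)
    moreover have "P = (restrict P (W - {v}))(v := P v)"
      using PE by (auto simp: PiE_def extensional_def restrict_def)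
    ultimately have "P \<in> ?C"
      using True by (intro image_eqI[of _ _ "(P v, restrict P (W - {v}))"]) auto
    then show ?thesis ..
  next
    case False
    then have "P(v := P v - k) \<in> rpark R W (F - root_edges v)"
      using rpark_delete[OF v PE] P by (simp add: k_def)
    then have "P \<in> ?D"
      using False by (intro image_eqI[of _ _ "P(v := P v - k)"]) auto
    then show ?thesis ..
  qed
next
  fix P assume "P \<in> ?C \<union> ?D"
  then show "P \<in> rpark R W F"
  proof
    assume "P \<in> ?C"
    then obtain a P' where a: "a < k" and P': "P' \<in> rpark (insert v R) (W - {v}) (F - root_edges v)"
      and P: "P = P'(v := a)"
      by auto
    have "P' \<in> (W - {v}) \<rightarrow>\<^sub>E UNIV"
      using P' by (simp add: rpark_def)
    then have "P \<in> W \<rightarrow>\<^sub>E UNIV" "restrict P (W - {v}) = P'"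
      using v by (auto simp: P PiE_def extensional_def restrict_def)
    then show ?thesis
      using rpark_contract[OF v, of P] a P' P by (simp add: k_def)
  next
    assume "P \<in> ?D"
    then obtain P' where P': "P' \<in> rpark R W (F - root_edges v)" and P: "P = P'(v := P' v + k)"
      by auto
    have "P' \<in> W \<rightarrow>\<^sub>E UNIV"
      using P' by (simp add: rpark_def)
    then have "P \<in> W \<rightarrow>\<^sub>E UNIV"
      using v by (auto simp: P PiE_def extensional_def)
    then show ?thesis
      using rpark_delete[OF v, of P] P' P by (simp add: k_def)
  qed
qed

end

text \<open>With \<open>R = {0}\<close> and \<open>W = {1..n}\<close> the exponent is the codegree,
  since \<open>card W\<close> is one less than the number of vertices.\<close>

definition park_enum :: "'r::comm_ring_1 \<Rightarrow> 'a set \<Rightarrow> 'a set \<Rightarrow> 'a set set \<Rightarrow> 'r" where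
  "park_enum q R W F = (\<Sum>P\<in>rpark R W F. q ^ (card F - card W - (\<Sum>i\<in>W. P i)))"

definition rconn_enum :: "'r::comm_ring_1 \<Rightarrow> 'a set \<Rightarrow> 'a set \<Rightarrow> 'a set set \<Rightarrow> 'r" where
  "rconn_enum q R W F = (\<Sum>A | A \<subseteq> F \<and> rconn R W A. (q - 1) ^ (card A - card W))"

section \<open>The common recursion of parking functions and connected edge sets\<close>

context rooted_graph
begin

text \<open>In the contracted case the value \<open>a < k\<close> at \<open>v\<close> leaves
  \<open>k - 1 - a\<close> in the exponent, which runs through \<open>0, ..., k - 1\<close>. In the
  deleted case the loss of \<open>k\<close> edges and of \<open>k\<close> in \<open>P v\<close>
  cancel.\<close>

lemma park_enum_rec:
  assumes v: "v \<in> W"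
  shows "park_enum q R W F =
    qint q (card (root_edges v)) * park_enum q (insert v R) (W - {v}) (F - root_edges v)
    + park_enum q R W (F - root_edges v)"
proof -
  let ?F = "F - root_edges v"
  define k where "k = card (root_edges v)"
  let ?c = "\<lambda>(a, P). P(v := a)" and ?d = "\<lambda>P. P(v := P v + k)"
  let ?PC = "rpark (insert v R) (W - {v}) ?F" and ?PD = "rpark R W ?F"
  let ?C = "?c ` ({..<k} \<times> ?PC)" and ?D = "?d ` ?PD"
  let ?w = "\<lambda>P. q ^ (card F - card W - (\<Sum>i\<in>W. P i))"
  have finP: "finite ?PC" "finite ?PD"
    using fin by (auto intro!: finite_rpark)
  have cW: "card W = Suc (card (W - {v}))"
    using v fin by (metis card_Suc_Diff1)
  have cF: "card F = k + card ?F"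
    using card_delete[of v] by (simp add: k_def)
  \<comment> \<open>Functions on \<open>W - {v}\<close> are \<open>undefined\<close> at
    \<open>v\<close>, so overwriting this value loses no information.\<close>
  have Pv: "P v = undefined" if "P \<in> ?PC" for P
    using that by (auto simp: rpark_def PiE_def extensional_def)
  have injc: "inj_on ?c ({..<k} \<times> ?PC)"
  proof (rule inj_onI)
    fix x y assume x: "x \<in> {..<k} \<times> ?PC" and y: "y \<in> {..<k} \<times> ?PC" and eq: "?c x = ?c y"
    obtain a P b Q where xy: "x = (a, P)" "y = (b, Q)"
      by (cases x; cases y) auto
    have eq': "P(v := a) = Q(v := b)"
      using eq by (simp add: xy)
    then have "a = b"
      by (metis fun_upd_same)
    moreover have "P u = Q u" for u
      using fun_cong[OF eq', of u] Pv[of P] Pv[of Q] x y xy by (cases "u = v") auto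
    ultimately show "x = y"
      using xy by auto
  qed
  have injd: "inj_on ?d ?PD"
  proof (rule inj_onI)
    fix P Q assume eq: "?d P = ?d Q"
    have "P u = Q u" for u
      using fun_cong[OF eq, of u] by (cases "u = v") auto
    then show "P = Q"
      by auto
  qed
  have wc: "?w (P(v := a)) = q ^ (k - Suc a) * q ^ (card ?F - card (W - {v}) - (\<Sum>i\<in>W - {v}. P i))"
    if "a < k" "P \<in> ?PC" for a P
  proof -
    have "(\<Sum>i\<in>W. (P(v := a)) i) = a + (\<Sum>i\<in>W - {v}. P i)"
      using v fin by (simp add: sum.remove)
    moreover have "card (W - {v}) + (\<Sum>i\<in>W - {v}. P i) \<le> card ?F"
      using that fin by (intro rpark_bound) auto
    ultimately have "card F - card W - (\<Sum>i\<in>W. (P(v := a)) i)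
      = (k - Suc a) + (card ?F - card (W - {v}) - (\<Sum>i\<in>W - {v}. P i))"
      using that cF cW by linarith
    then show ?thesis
      by (simp only: power_add)
  qed
  have wd: "?w (P(v := P v + k)) = q ^ (card ?F - card W - (\<Sum>i\<in>W. P i))" if "P \<in> ?PD" for P
  proof -
    have "(\<Sum>i\<in>W. (P(v := P v + k)) i) = k + (\<Sum>i\<in>W. P i)"
      using v fin by (simp add: sum.remove)
    then have "card F - card W - (\<Sum>i\<in>W. (P(v := P v + k)) i) = card ?F - card W - (\<Sum>i\<in>W. P i)"
      using cF by linarith
    then show ?thesis
      by (simp only:)
  qed
  have "?C \<inter> ?D = {}"
    by (auto dest!: fun_cong[of _ _ v])
  then have "park_enum q R W F = (\<Sum>P\<in>?C. ?w P) + (\<Sum>P\<in>?D. ?w P)"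
    unfolding park_enum_def rpark_split[OF v] k_def[symmetric] using finP
    by (intro sum.union_disjoint) auto
  also have "(\<Sum>P\<in>?D. ?w P) = park_enum q R W ?F"
    unfolding sum.reindex[OF injd] park_enum_def by (intro sum.cong refl) (simp only: o_def wd)
  also have "(\<Sum>P\<in>?C. ?w P) = (\<Sum>(a, P)\<in>{..<k} \<times> ?PC.
      q ^ (k - Suc a) * q ^ (card ?F - card (W - {v}) - (\<Sum>i\<in>W - {v}. P i)))"
    unfolding sum.reindex[OF injc] by (intro sum.cong refl) (auto simp only: o_def prod.case wc mem_Sigma_iff lessThan_iff split: prod.splits)
  also have "\<dots> = (\<Sum>a<k. q ^ (k - Suc a)) * park_enum q (insert v R) (W - {v}) ?F"
    unfolding park_enum_def by (simp add: sum_product sum.cartesian_product)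
  also have "(\<Sum>a<k. q ^ (k - Suc a)) = qint q k"
    unfolding qint_def by (rule sum.nat_diff_reindex)
  finally show ?thesis
    by (simp add: k_def)
qed

lemma rconn_contract:
  assumes v: "v \<in> W" and A: "A \<subseteq> F" and X: "A \<inter> root_edges v \<noteq> {}"
  shows "rconn R W A \<longleftrightarrow> rconn (insert v R) (W - {v}) (A - root_edges v)"
proof -
  have 1: "(\<exists>i\<in>S. \<exists>j\<in>insert v R \<union> (W - {v}) - S. {i, j} \<in> A - root_edges v) \<longleftrightarrow>
    (\<exists>i\<in>S. \<exists>j\<in>R \<union> W - S. {i, j} \<in> A)" if S: "S \<subseteq> W - {v}" for S
    unfolding contract_complement[OF v S]
  proof (intro bex_cong refl)
    fix i j assume i: "i \<in> S"
    then show "{i, j} \<in> A - root_edges v \<longleftrightarrow> {i, j} \<in> A"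
      using S root_edges_iff[OF v, of i j] by auto
  qed
  have 2: "\<exists>i\<in>S. \<exists>j\<in>R \<union> W - S. {i, j} \<in> A" if S: "v \<in> S" "S \<subseteq> W" for S
  proof -
    obtain j where "j \<in> R" "{v, j} \<in> A"
      using X by (auto simp: root_edges_def)
    then show ?thesis
      using S disj by blast
  qed
  show ?thesis
    using all_subsets_remove[of W v, OF 1 2] unfolding rconn_def .
qed

text \<open>The sets \<open>A\<close> are sorted by \<open>X = A \<inter> root_edges v\<close>: any
  nonempty \<open>X\<close> has the effect of contraction, and these \<open>X\<close> contribute a
  \<open>q\<close>-integer in total; an empty \<open>X\<close> leaves a subset of the deleted
  graph.\<close>

lemma rconn_enum_rec:
  assumes v: "v \<in> W"
  shows "rconn_enum q R W F =
    qint q (card (root_edges v)) * rconn_enum q (insert v R) (W - {v}) (F - root_edges v)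
    + rconn_enum q R W (F - root_edges v)"
proof -
  let ?K = "root_edges v" and ?F = "F - root_edges v"
  let ?SC = "{A. A \<subseteq> ?F \<and> rconn (insert v R) (W - {v}) A}" and ?SD = "{A. A \<subseteq> ?F \<and> rconn R W A}"
  let ?c = "\<lambda>(X, A). X \<union> A"
  let ?C = "?c ` ((Pow ?K - {{}}) \<times> ?SC)"
  let ?w = "\<lambda>A. (q - 1) ^ (card A - card W)"
  have finS: "finite ?SC" "finite ?SD" "finite ?K"
    using fin finite_root_edges by (auto intro: finite_subset[of _ "Pow F"])
  have cW: "card W = Suc (card (W - {v}))"
    using v fin by (metis card_Suc_Diff1)
  have split: "{A. A \<subseteq> F \<and> rconn R W A} = ?C \<union> ?SD"
  proof (intro equalityI subsetI)
    fix A assume "A \<in> {A. A \<subseteq> F \<and> rconn R W A}"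
    then have A: "A \<subseteq> F" "rconn R W A"
      by auto
    show "A \<in> ?C \<union> ?SD"
    proof (cases "A \<inter> ?K = {}")
      case True
      then show ?thesis
        using A by auto
    next
      case False
      then have "rconn (insert v R) (W - {v}) (A - ?K)"
        using rconn_contract[OF v A(1)] A(2) by blast
      then have "A \<in> ?C"
        using A False by (intro image_eqI[of _ _ "(A \<inter> ?K, A - ?K)"]) auto
      then show ?thesis ..
    qed
  next
    fix A assume "A \<in> ?C \<union> ?SD"
    then show "A \<in> {A. A \<subseteq> F \<and> rconn R W A}"
    proof
      assume "A \<in> ?C"
      then obtain X A' where X: "X \<subseteq> ?K" "X \<noteq> {}" and A': "A' \<subseteq> ?F" "rconn (insert v R) (W - {v}) A'"
        and A: "A = X \<union> A'"
        by auto
      have AK: "A - ?K = A'" "A \<inter> ?K \<noteq> {}" and AF: "A \<subseteq> F"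
        using X A' root_edges_subset by (auto simp: A)
      then show ?thesis
        using rconn_contract[OF v AF AK(2)] A' by simp
    qed auto
  qed
  have inj: "inj_on ?c ((Pow ?K - {{}}) \<times> ?SC)"
    by (rule inj_onI) auto
  have wc: "?w (X \<union> A) = (q - 1) ^ (card X - 1) * (q - 1) ^ (card A - card (W - {v}))"
    if "X \<subseteq> ?K" "X \<noteq> {}" "A \<in> ?SC" for X A
  proof -
    have "finite X" "finite A"
      using that finS fin by (auto intro: finite_subset)
    moreover have "X \<inter> A = {}"
      using that by auto
    ultimately have "card (X \<union> A) = card X + card A" "card X > 0"
      using that by (auto simp: card_Un_disjoint card_gt_0_iff)
    moreover have "card (W - {v}) \<le> card A"
      using that fin \<open>finite A\<close> by (intro rconn_bound[of "insert v R"]) auto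
    ultimately have "card (X \<union> A) - card W = (card X - 1) + (card A - card (W - {v}))"
      using cW by linarith
    then show ?thesis
      by (simp only: power_add)
  qed
  have "?C \<inter> ?SD = {}"
    by auto
  then have "rconn_enum q R W F = (\<Sum>A\<in>?C. ?w A) + (\<Sum>A\<in>?SD. ?w A)"
    unfolding rconn_enum_def split using finS
    by (intro sum.union_disjoint) auto
  also have "(\<Sum>A\<in>?C. ?w A) = (\<Sum>(X, A)\<in>(Pow ?K - {{}}) \<times> ?SC.
      (q - 1) ^ (card X - 1) * (q - 1) ^ (card A - card (W - {v})))"
    unfolding sum.reindex[OF inj] by (intro sum.cong refl) (auto simp del: One_nat_def intro!: wc)
  also have "\<dots> = (\<Sum>X\<in>Pow ?K - {{}}. (q - 1) ^ (card X - 1))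
      * rconn_enum q (insert v R) (W - {v}) ?F"
    unfolding rconn_enum_def by (simp only: sum_product sum.cartesian_product)
  also have "(\<Sum>X\<in>Pow ?K - {{}}. (q - 1) ^ (card X - 1)) = qint q (card ?K)"
    using sum_nonempty_subsets[OF finS(3), of "q - 1"] by simp
  finally show ?thesis
    by (simp add: rconn_enum_def)
qed

end

text \<open>Both sides obey the same recursion, applied at an unburned vertex with an edge to
  \<open>R\<close>. If there is none and \<open>W\<close> is nonempty, then \<open>S = W\<close>
  violates both conditions and both sums are empty; if \<open>W\<close> is empty, both are
  1.\<close>

lemma park_enum_eq_rconn_enum:
  assumes "rooted_graph R W F"
  shows "park_enum q R W F = rconn_enum q R W F"
  using assms
proof (induction "card F + card W" arbitrary: R W F rule: less_induct)
  case less
  interpret rooted_graph R W F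
    by fact
  consider "W = {}" | "W \<noteq> {}" "\<And>v. v \<in> W \<Longrightarrow> root_edges v = {}"
    | v where "v \<in> W" "root_edges v \<noteq> {}"
    by blast
  then show ?case
  proof cases
    case 1
    then have "F = {}"
      using sub nsub by auto
    then show ?thesis
      using 1 by (simp add: park_enum_def rconn_enum_def rpark_def rconn_def)
  next
    case 2
    have "{i, j} \<notin> F" if "i \<in> W" "j \<in> R \<union> W - W" for i j
      using 2(2)[of i] that by (auto simp: root_edges_def)
    then have *: "{j \<in> R \<union> W - W. {i, j} \<in> F} = {}" if "i \<in> W" for i
      using that by blast
    have "rpark R W F = {}"
    proof -
      have False if "P \<in> rpark R W F" for P
      proof -
        have "\<exists>i\<in>W. P i < card {j \<in> R \<union> W - W. {i, j} \<in> F}"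
          using that 2(1) unfolding rpark_def by blast
        then show False
          using * by (metis card.empty not_less0)
      qed
      then show ?thesis
        by blast
    qed
    moreover have "\<not> rconn R W A" if "A \<subseteq> F" for A
    proof
      assume "rconn R W A"
      then obtain i j where "i \<in> W" "j \<in> R \<union> W - W" "{i, j} \<in> A"
        using 2(1) unfolding rconn_def by blast
      then show False
        using * that by blast
    qed
    then have "{A. A \<subseteq> F \<and> rconn R W A} = {}"
      by blast
    ultimately show ?thesis
      by (simp only: park_enum_def rconn_enum_def sum.empty)
  next
    case 3
    have "card (root_edges v) > 0"
      using 3 finite_root_edges by (simp add: card_gt_0_iff)
    then have "card (F - root_edges v) < card F"
      using card_delete[of v] by linarith
    moreover have "card (W - {v}) \<le> card W"
      using fin by (intro card_mono) auto
    ultimately show ?thesis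
      unfolding park_enum_rec[OF 3(1)] rconn_enum_rec[OF 3(1)]
      using less.hyps[OF _ contract[OF 3(1)]] less.hyps[OF _ delete[of v]] by simp
  qed
qed

section \<open>The Tutte polynomial and spanning trees\<close>

lemma simple_path_rtrancl:
  "simple_path A p \<Longrightarrow> (hd p, last p) \<in> {(u, v). {u, v} \<in> A}\<^sup>*"
proof (induction p rule: induct_list012)
  case (3 x y p)
  then show ?case
    by (auto intro: converse_rtrancl_into_rtrancl)
qed auto

lemma simple_path_crossing:
  assumes "simple_path A p" "hd p \<in> S \<longleftrightarrow> last p \<notin> S"
  shows "\<exists>x\<in>set p \<inter> S. \<exists>y\<in>set p - S. {x, y} \<in> A"
  using assms
proof (induction p rule: induct_list012)
  case (3 x y p)
  show ?case
  proof (cases "x \<in> S \<longleftrightarrow> y \<in> S")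
    case True
    then have "\<exists>u\<in>set (y # p) \<inter> S. \<exists>v\<in>set (y # p) - S. {u, v} \<in> A"
      using "3.prems" by (intro "3.IH"(2)) auto
    then show ?thesis
      by auto
  next
    case False
    moreover have "{x, y} \<in> A" "{y, x} \<in> A"
      using "3.prems"(1) by (auto simp: insert_commute)
    ultimately show ?thesis
      by (cases "x \<in> S") force+
  qed
qed auto

lemma connected_graph_iff_conn:
  assumes A: "A \<subseteq> Pow V"
  shows "connected_graph V A \<longleftrightarrow> conn V A"
proof
  assume con: "connected_graph V A"
  have "\<exists>a\<in>S. \<exists>b\<in>V - S. {a, b} \<in> A" if S: "S \<subseteq> V" "S \<noteq> {}" "S \<noteq> V" for S
  proof (rule ccontr)
    assume *: "\<not> (\<exists>a\<in>S. \<exists>b\<in>V - S. {a, b} \<in> A)"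
    obtain a b where a: "a \<in> S" and b: "b \<in> V - S"
      using S by blast
    have "(a, b) \<in> {(u, v). {u, v} \<in> A}\<^sup>*"
      using con a b S unfolding connected_graph_def conn_rel_def by blast
    then have "b \<in> S"
    proof induction
      case (step y z)
      then have "{y, z} \<in> A"
        by simp
      moreover from this have "z \<in> V"
        using A by auto
      ultimately show ?case
        using * step by blast
    qed (rule a)
    then show False
      using b by blast
  qed
  then show "conn V A"
    using con by (auto simp: conn_def connected_graph_def)
next
  assume con: "conn V A"
  have "(a, b) \<in> {(u, v). {u, v} \<in> A}\<^sup>*" if "a \<in> V" "b \<in> V" for a b
    using conn_simple_path[OF con that] simple_path_rtrancl by blast
  then show "connected_graph V A"
    using con by (auto simp: conn_def connected_graph_def conn_rel_def)
qed

lemma equiv_conn_rel: "equiv V (conn_rel V A)"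
proof (rule equivI)
  show "conn_rel V A \<subseteq> V \<times> V"
    by (auto simp: conn_rel_def)
  show "refl_on V (conn_rel V A)"
    by (auto simp: conn_rel_def refl_on_def)
  have "sym {(u, v). {u, v} \<in> A}"
    by (auto simp: sym_def insert_commute)
  then show "sym (conn_rel V A)"
    unfolding conn_rel_def by (intro sym_Int sym_rtrancl) (auto simp: sym_def)
  show "trans (conn_rel V A)"
    unfolding conn_rel_def by (intro trans_Int trans_rtrancl) (auto simp: trans_def)
qed

lemma num_components_pos:
  assumes "finite V" "V \<noteq> {}"
  shows "num_components V A > 0"
  using assms by (auto simp: num_components_def card_gt_0_iff quotient_def)

lemma num_components_eq_1_iff:
  assumes V: "finite V" "V \<noteq> {}"
  shows "num_components V A = 1 \<longleftrightarrow> connected_graph V A"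
proof
  assume "num_components V A = 1"
  then obtain C where C: "V // conn_rel V A = {C}"
    by (auto simp: num_components_def card_1_singleton_iff)
  have "(a, b) \<in> conn_rel V A" if "a \<in> V" "b \<in> V" for a b
  proof -
    have "conn_rel V A `` {a} = conn_rel V A `` {b}"
      using C that quotientI[of a V "conn_rel V A"] quotientI[of b V "conn_rel V A"] by simp
    then show ?thesis
      using eq_equiv_class_iff[OF equiv_conn_rel that] by simp
  qed
  moreover have "conn_rel V A \<subseteq> V \<times> V"
    by (auto simp: conn_rel_def)
  ultimately show "connected_graph V A"
    using V by (auto simp: connected_graph_def)
next
  assume "connected_graph V A"
  then have "conn_rel V A = V \<times> V"
    by (simp add: connected_graph_def)
  then have "V // conn_rel V A = {V}"
    using V(2) by (auto simp: quotient_def)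
  then show "num_components V A = 1"
    by (simp add: num_components_def)
qed

section \<open>Comparison with the Tutte polynomial and with acyclic edge sets\<close>

context simple_graph
begin

text \<open>At \<open>x = 1\<close> the factor \<open>0 ^ (num_components V A - 1)\<close> is 1 for
  connected \<open>A\<close> and 0 otherwise.\<close>

lemma tutte_1_eq_conn_enum:
  assumes V: "finite V" "V \<noteq> {}" and E: "E \<subseteq> Pow V" and con: "connected_graph V E"
  shows "tutte V E 1 q = conn_enum q V"
proof -
  have fin: "finite (Pow E)"
    using E V(1) by (meson finite_Pow_iff finite_subset)
  have sub: "conn_subs V \<subseteq> Pow E"
    by (auto simp: conn_subs_def)
  have E1: "num_components V E = 1"
    using con V num_components_eq_1_iff by blast
  have iff: "num_components V A = 1 \<longleftrightarrow> A \<in> conn_subs V" if "A \<subseteq> E" for A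
    unfolding num_components_eq_1_iff[OF V] conn_subs_def
    using that E connected_graph_iff_conn[of A V] by auto
  let ?t = "\<lambda>A. (1 - 1) ^ (num_components V A - num_components V E)
    * (q - 1) ^ (num_components V A + card A - card V)"
  have "tutte V E 1 q = (\<Sum>A\<in>Pow E. ?t A)"
    by (simp only: tutte_def)
  also have "\<dots> = (\<Sum>A\<in>conn_subs V. ?t A)"
  proof (rule sum.mono_neutral_right[OF fin sub], rule ballI)
    fix A assume A: "A \<in> Pow E - conn_subs V"
    then have "num_components V A - num_components V E > 0"
      using iff[of A] E1 num_components_pos[OF V, of A] by auto
    then show "?t A = 0"
      by (simp add: power_0_left)
  qed
  also have "\<dots> = conn_enum q V"
    unfolding conn_enum_def
  proof (rule sum.cong[OF refl])
    fix A assume "A \<in> conn_subs V"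
    then have "num_components V A = 1"
      using iff[of A] sub by auto
    then show "?t A = (q - 1) ^ (card A + 1 - card V)"
      by (simp add: E1 add.commute)
  qed
  finally show ?thesis .
qed

text \<open>Induction along the split at \<open>r\<close>: two edges from \<open>r\<close> to
  \<open>B\<close> together with a path inside \<open>B\<close> between their ends would form a
  cycle, so exactly one edge joins \<open>r\<close> to \<open>B\<close>.\<close>

lemma acyclic_card:
  assumes "finite V" "T \<in> conn_subs V" "acyclic_graph T"
  shows "card T + 1 = card V"
  using assms
proof (induction "card V" arbitrary: V T rule: less_induct)
  case less
  have "V \<noteq> {}"
    using less.prems by (auto simp: conn_subs_def conn_def)
  then obtain r where r: "r \<in> V"
    by blast
  show ?case
  proof (cases "V = {r}")
    case True
    then show ?thesis
      using less.prems(2) by (simp add: conn_subs_singleton)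
  next
    case False
    then obtain v where v: "v \<in> V - {r}"
      using r by blast
    obtain B where B: "component V r v T B"
      using component_exists[of v V r T] v by auto
    note split = component_split[OF r less.prems(2) B]
    have BV: "B \<subset> V" "V - B \<subset> V" "B \<subseteq> V - {r}" "r \<notin> B"
      using B r by (auto simp: component_def)
    have fin: "finite B" "finite (V - B)"
      using less.prems(1) BV finite_subset[of B V] by auto
    have acyc: "acyclic_graph (T \<inter> U)" for U
      using less.prems(3) simple_path_mono[of "T \<inter> U" _ T] unfolding acyclic_graph_def by blast
    have "card (T \<inter> Pow B) + 1 = card B"
      by (rule less.hyps[OF psubset_card_mono[OF less.prems(1) BV(1)] fin(1) split(2) acyc])
    moreover have "card (T \<inter> Pow (V - B)) + 1 = card (V - B)"
      by (rule less.hyps[OF psubset_card_mono[OF less.prems(1) BV(2)] fin(2) split(3) acyc])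
    moreover have "card T = card (T \<inter> star r B) + card (T \<inter> Pow B) + card (T \<inter> Pow (V - B))"
      using conn_subs_glue_card[OF less.prems(1) BV(3) Int_lower2[of T] split(2,3)]
      unfolding split(4)[symmetric] .
    moreover have "card V = card B + card (V - B)"
      using less.prems(1) BV by (intro card_split) auto
    moreover have "card (T \<inter> star r B) = 1"
    proof -
      obtain e where e: "e \<in> T \<inter> star r B"
        using split(1) by blast
      have "e' = e" if e': "e' \<in> T \<inter> star r B" for e'
      proof (rule ccontr)
        assume ne: "e' \<noteq> e"
        obtain a b where a: "a \<in> B" "e = {r, a}" and b: "b \<in> B" "e' = {r, b}"
          using e e' by (auto simp: star_def)
        have "a \<noteq> b"
          using a b ne by auto
        have cB: "conn B (T \<inter> Pow B)"
          using split(2) by (simp add: conn_subs_def)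
        obtain p where p: "simple_path (T \<inter> Pow B) p" "hd p = a" "last p = b"
          using conn_simple_path[OF cB a(1) b(1)] by blast
        obtain x y p' where p': "p = x # y # p'"
          using p \<open>a \<noteq> b\<close> by (cases p rule: remdups_adj.cases) auto
        have "set p \<subseteq> B"
          using simple_path_subset[OF p(1)] p(2) a(1) by auto
        then have "simple_path T (r # p)"
          using p p' a e BV(4) simple_path_mono[OF p(1), of T] by auto
        moreover have "3 \<le> length (r # p)" "{last (r # p), hd (r # p)} \<in> T"
          using p p' b e' by (auto simp: insert_commute)
        ultimately show False
          using less.prems(3) unfolding acyclic_graph_def by blast
      qed
      then have "T \<inter> star r B = {e}"
        using e by blast
      then show ?thesis
        by simp
    qed
    ultimately show ?thesis
      by linarith
  qed
qed

text \<open>Removing an edge of a cycle keeps the graph connected, as the rest of the cycle crosses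
  every cut that the edge crosses. The smaller set would violate
  \<open>conn_subs_card\<close>.\<close>

lemma card_acyclic:
  assumes V: "finite V" and T: "T \<in> conn_subs V" and card: "card T + 1 = card V"
  shows "acyclic_graph T"
  unfolding acyclic_graph_def
proof
  assume "\<exists>p. simple_path T p \<and> 3 \<le> length p \<and> {last p, hd p} \<in> T"
  then obtain p where p: "simple_path T p" "3 \<le> length p" and e: "{last p, hd p} \<in> T"
    by blast
  let ?T = "T - {{last p, hd p}}"
  have dist: "distinct p" and "p \<noteq> []"
    using p by (auto simp: simple_path_def)
  have "simple_path ?T p"
    unfolding simple_path_def
  proof (intro conjI allI impI)
    fix k assume k: "Suc k < length p"
    \<comment> \<open>Since \<open>p\<close> is distinct, one of its steps can join its two ends
      only if \<open>p\<close> has length 2.\<close>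
    have "{p ! k, p ! Suc k} \<noteq> {last p, hd p}"
    proof
      assume "{p ! k, p ! Suc k} = {last p, hd p}"
      then have "p ! k = p ! (length p - 1) \<and> p ! Suc k = p ! 0 \<or>
        p ! k = p ! 0 \<and> p ! Suc k = p ! (length p - 1)"
        using \<open>p \<noteq> []\<close> by (auto simp: doubleton_eq_iff last_conv_nth hd_conv_nth)
      moreover have "k < length p" "0 < length p" "length p - 1 < length p"
        using k by auto
      ultimately have "Suc k = 0 \<or> k = 0 \<and> Suc k = length p - 1"
        using k nth_eq_iff_index_eq[OF dist] by blast
      then show False
        using p(2) by auto
    qed
    then show "{p ! k, p ! Suc k} \<in> ?T"
      using p(1) k by (auto simp: simple_path_def)
  qed (use dist \<open>p \<noteq> []\<close> in auto)
  note path = this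
  have TV: "T \<subseteq> Pow V" "conn V T"
    using T by (auto simp: conn_subs_def)
  have "hd p \<in> V"
    using e TV by auto
  then have pV: "set p \<subseteq> V"
    using simple_path_subset[OF p(1) TV(1)] by simp
  have "conn V ?T"
    unfolding conn_def
  proof (intro conjI allI impI)
    show "V \<noteq> {}"
      using TV by (auto simp: conn_def)
    fix S assume "S \<subseteq> V" "S \<noteq> {}" "S \<noteq> V"
    then obtain a b where ab: "a \<in> S" "b \<in> V - S" "{a, b} \<in> T"
      using conn_cut[OF TV(2)] by metis
    show "\<exists>a\<in>S. \<exists>b\<in>V - S. {a, b} \<in> ?T"
    proof (cases "{a, b} = {last p, hd p}")
      case True
      then have "hd p \<in> S \<longleftrightarrow> last p \<notin> S"
        using ab by (auto simp: doubleton_eq_iff)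
      from simple_path_crossing[OF path this] show ?thesis
        using pV by blast
    next
      case False
      then show ?thesis
        using ab by blast
    qed
  qed
  then have "?T \<in> conn_subs V"
    using T by (auto simp: conn_subs_def)
  then have "card V \<le> card ?T + 1"
    by (rule conn_subs_card[OF V])
  moreover have "card ?T < card T"
    using e conn_subs_finite[OF T V] by (intro psubset_card_mono) auto
  ultimately show False
    using card by linarith
qed

lemma spanning_trees_eq_trees:
  assumes "finite V" "E \<subseteq> Pow V"
  shows "spanning_trees V E = trees V"
proof -
  have "T \<in> spanning_trees V E \<longleftrightarrow> T \<in> conn_subs V \<and> acyclic_graph T" for T
    using assms(2) connected_graph_iff_conn[of T V]
    by (auto simp: spanning_trees_def conn_subs_def)
  then show ?thesis
    using acyclic_card[OF assms(1)] card_acyclic[OF assms(1)] by (auto simp: trees_def)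
qed

lemma rconn_enum_eq_conn_enum:
  assumes V: "finite V" "r \<in> V" and E: "E \<subseteq> Pow V"
  shows "rconn_enum q {r} (V - {r}) E = conn_enum q V"
proof -
  have rV: "{r} \<union> (V - {r}) = V"
    using V by auto
  have "rconn {r} (V - {r}) A \<longleftrightarrow> conn V A" for A
    unfolding rconn_def rV conn_root[OF V(2)] ..
  then have "{A. A \<subseteq> E \<and> rconn {r} (V - {r}) A} = conn_subs V"
    using E by (auto simp: conn_subs_def)
  moreover have "card V = Suc (card (V - {r}))"
    using V by (metis card_Suc_Diff1)
  ultimately show ?thesis
    by (simp add: rconn_enum_def conn_enum_def)
qed

end

section \<open>Threshold graphs are shifted\<close>

lemma threshold_edges:
  "threshold V E \<Longrightarrow> finite V \<and> (\<forall>e\<in>E. \<exists>u v. u \<in> V \<and> v \<in> V \<and> u \<noteq> v \<and> e = {u, v})"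
proof (induction rule: threshold.induct)
  case (isolated V E v)
  then show ?case
    by blast
next
  case (dominating V E v)
  then show ?case
    by blast
qed auto

text \<open>Neighbourhoods in a threshold graph are nested, up to the two vertices themselves. A new
  isolated vertex is below all others, a new dominating one above; between old vertices the
  comparison persists, since the new vertex is adjacent to both or to neither.\<close>

lemma threshold_nested:
  "threshold V E \<Longrightarrow> u \<in> V \<Longrightarrow> v \<in> V \<Longrightarrow>
    (\<forall>k. {u, k} \<in> E \<longrightarrow> k \<noteq> v \<longrightarrow> {v, k} \<in> E) \<or> (\<forall>k. {v, k} \<in> E \<longrightarrow> k \<noteq> u \<longrightarrow> {u, k} \<in> E)"
proof (induction arbitrary: u v rule: threshold.induct)
  case (isolated V E w)
  have "{w, k} \<notin> E" for k
    using threshold_edges[OF isolated(1)] isolated(2) by (metis insert_iff singletonD)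
  then show ?case
    using isolated by (cases "u = w"; cases "v = w") auto
next
  case (dominating V E w)
  let ?E = "E \<union> {{w, u} | u. u \<in> V}"
  have V: "k \<in> V" if "{x, k} \<in> E" for x k
    using threshold_edges[OF dominating(1)] that by (metis insert_iff singletonD)
  have dom: "{w, k} \<in> ?E" "{k, w} \<in> ?E" if "k \<in> V" for k
    using that by (auto simp: insert_commute)
  have nbr: "{x, k} \<in> E \<or> k = w" if "{x, k} \<in> ?E" "x \<in> V" for x k
    using that dominating(2) by (auto simp: doubleton_eq_iff)
  show ?case
  proof (cases "u = w \<or> v = w")
    case True
    then show ?thesis
    proof
      assume u: "u = w"
      have "{w, k} \<in> ?E" if "{v, k} \<in> ?E" "k \<noteq> w" for k
        using nbr[OF that(1)] that V[of v k] dom[of k] dominating.prems(2)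
        by (cases "v = w") auto
      then show ?thesis
        using u by blast
    next
      assume v: "v = w"
      have "{w, k} \<in> ?E" if "{u, k} \<in> ?E" "k \<noteq> w" for k
        using nbr[OF that(1)] that V[of u k] dom[of k] dominating.prems(1)
        by (cases "u = w") auto
      then show ?thesis
        using v by blast
    qed
  next
    case False
    then have uv: "u \<in> V" "v \<in> V"
      using dominating.prems by auto
    have lift: "{y, k} \<in> ?E" if "\<forall>k. {x, k} \<in> E \<longrightarrow> k \<noteq> y \<longrightarrow> {y, k} \<in> E" "x \<in> V" "y \<in> V"
      "{x, k} \<in> ?E" "k \<noteq> y" for x y k
    proof (cases "k = w")
      case True
      then show ?thesis
        using dom(2)[OF that(3)] by simp
    next
      case False
      then have "{x, k} \<in> E"
        using nbr[OF that(4,2)] by simp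
      then show ?thesis
        using that by simp
    qed
    from dominating.IH[OF uv] show ?thesis
    proof
      assume "\<forall>k. {u, k} \<in> E \<longrightarrow> k \<noteq> v \<longrightarrow> {v, k} \<in> E"
      from lift[OF this uv] show ?thesis
        by (intro disjI1 allI impI)
    next
      assume "\<forall>k. {v, k} \<in> E \<longrightarrow> k \<noteq> u \<longrightarrow> {u, k} \<in> E"
      from lift[OF this uv(2,1)] show ?thesis
        by (intro disjI2 allI impI)
    qed
  qed
qed auto

lemma deg_eq_card_neighbours:
  assumes "\<And>e. e \<in> E \<Longrightarrow> \<exists>u v. e = {u, v}"
  shows "deg E v = card {k. {v, k} \<in> E}"
proof -
  have "{e \<in> E. v \<in> e} = (\<lambda>k. {v, k}) ` {k. {v, k} \<in> E}"
    using assms by (fastforce simp: insert_commute)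
  moreover have "inj_on (\<lambda>k. {v, k}) {k. {v, k} \<in> E}"
    by (auto simp: inj_on_def doubleton_eq_iff)
  ultimately show ?thesis
    by (simp add: deg_def card_image)
qed

text \<open>Of the two inclusions in \<open>threshold_nested\<close> one gives the claim. The other,
  combined with the order of degrees, forces the neighbourhoods of \<open>i\<close> and
  \<open>j\<close> to agree apart from \<open>i\<close> and \<open>j\<close>.\<close>

lemma threshold_graph_shifted:
  assumes "threshold_graph n E"
  shows "shifted_graph E"
proof -
  have th: "threshold {0..n} E" and deg: "\<And>i j. i < j \<Longrightarrow> j \<le> n \<Longrightarrow> deg E j \<le> deg E i"
    using assms by (auto simp: threshold_graph_def)
  note edges = threshold_edges[OF th, THEN conjunct2, rule_format]
  show ?thesis
  proof unfold_locales
    fix e assume "e \<in> E"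
    then show "\<exists>u v. u \<noteq> v \<and> e = {u, v}"
      using edges by blast
  next
    fix i j k assume jk: "{j, k} \<in> E" and ij: "i < j" and ik: "i \<noteq> k"
    have j: "j \<in> {0..n}"
      using edges[OF jk] by (auto simp: doubleton_eq_iff)
    then have i: "i \<in> {0..n}"
      using ij by auto
    show "{i, k} \<in> E"
      using threshold_nested[OF th i j]
    proof
      assume *: "\<forall>k. {i, k} \<in> E \<longrightarrow> k \<noteq> j \<longrightarrow> {j, k} \<in> E"
      define N where "N v = {k. {v, k} \<in> E}" for v
      have "N v \<subseteq> {0..n}" for v
        using edges by (fastforce simp: N_def doubleton_eq_iff)
      then have fin: "finite (N v)" for v
        using finite_subset by blast
      have sub: "N i - {j} \<subseteq> N j - {i}"
      proof
        fix k assume k: "k \<in> N i - {j}"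
        then have "k \<noteq> i"
          using edges[of "{i, k}"] by (auto simp: N_def doubleton_eq_iff)
        then show "k \<in> N j - {i}"
          using k * by (auto simp: N_def)
      qed
      have degN: "deg E v = card (N v)" for v
        unfolding N_def using edges by (intro deg_eq_card_neighbours) blast
      have "card (N j) \<le> card (N i)"
        using deg[OF ij] j unfolding degN by simp
      \<comment> \<open>An edge between \<open>i\<close> and \<open>j\<close> counts in both
        degrees, so leaving it out preserves their comparison.\<close>
      moreover have "j \<in> N i \<longleftrightarrow> i \<in> N j"
        by (simp add: N_def insert_commute)
      ultimately have "card (N j - {i}) \<le> card (N i - {j})"
        by (simp add: card_Diff_singleton_if diff_le_mono)
      then have "N i - {j} = N j - {i}"
        using fin sub by (intro card_seteq) auto
      moreover have "k \<in> N j - {i}"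
        using jk ik by (auto simp: N_def)
      ultimately show ?thesis
        by (auto simp: N_def)
    qed (use jk ik in auto)
  qed
qed

section \<open>Inversions and \<kappa>-inversions in a shifted graph\<close>

context shifted_graph
begin

text \<open>The parent \<open>k\<close> of \<open>i\<close> is adjacent to \<open>i\<close>, and an
  inversion has \<open>j < i\<close>; so shiftedness makes \<open>k\<close> adjacent to
  \<open>j\<close>. The two differ because \<open>k\<close> comes before \<open>j\<close> on the
  path from 0.\<close>

lemma kappa_eq_inv_num:
  assumes T: "T \<subseteq> E"
  shows "kappa E T = inv_num T"
proof -
  have "\<exists>k. is_parent T k i \<and> {j, k} \<in> E" if ij: "(i, j) \<in> inversions T" for i j
  proof -
    have i: "i \<noteq> 0" "j < i" "i \<noteq> j"
      using ij by (auto simp: inversions_def)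
    obtain p where p: "simple_path T p" "hd p = 0" "last p = j" "i \<in> set p"
      using ij by (auto simp: inversions_def descendant_def)
    obtain p1 p2 where p12: "p = p1 @ i # p2"
      using p(4) by (auto simp: in_set_conv_decomp)
    have "p1 \<noteq> []"
      using p12 p(2) i(1) by (cases p1) auto
    then obtain p0 k where p1: "p1 = p0 @ [k]"
      by (metis append_butlast_last_id)
    have par: "simple_path T (p0 @ [k, i])" "hd (p0 @ [k, i]) = 0"
      using simple_path_append1[of T "p0 @ [k, i]" p2] p by (auto simp: p12 p1 hd_append)
    have "{(p0 @ [k, i]) ! length p0, (p0 @ [k, i]) ! Suc (length p0)} \<in> T"
      using par(1) unfolding simple_path_def by (metis length_append length_Cons list.size(3) add_Suc_right lessI Nat.add_0_right)
    then have "{k, i} \<in> E"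
      using T by (auto simp: nth_append)
    moreover have "j \<in> set p2"
      using p(3) i(3) by (auto simp: p12 split: if_splits)
    then have "j \<noteq> k"
      using p(1) by (auto simp: p12 p1 simple_path_def)
    ultimately have "{j, k} \<in> E"
      using shifted[of i k j] i(2) by (simp add: insert_commute)
    then show ?thesis
      using par unfolding is_parent_def by blast
  qed
  then have "{(i, j) \<in> inversions T. \<exists>k. is_parent T k i \<and> {j, k} \<in> E} = inversions T"
    by blast
  then show ?thesis
    by (simp add: kappa_def inv_num_def)
qed

end

lemma inv_num_eq: "inv_num T = card (rooted_inversions 0 T)"
  by (simp add: inv_num_def inversions_def rooted_inversions_def descendant_def dsc_def)

section \<open>Increasing trees\<close>

text \<open>The branch contains \<open>v\<close> itself, which \<open>dsc\<close> leaves
  out.\<close>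

definition branch_size :: "'a set set \<Rightarrow> 'a \<Rightarrow> 'a \<Rightarrow> nat" where
  "branch_size T r v = card {j. j = v \<or> dsc T r v j}"

lemma branch_size_root:
  assumes "conn V T" "T \<subseteq> Pow V" "r \<in> V"
  shows "branch_size T r r = card V"
proof -
  have "{j. j = r \<or> dsc T r r j} = V"
    using dsc_root[OF assms] assms(3) by auto
  then show ?thesis
    by (simp add: branch_size_def)
qed

context glued_tree
begin

lemma branch_size_branch: "v \<in> B \<Longrightarrow> branch_size T r v = branch_size T1 c v"
  by (simp add: branch_size_def dsc_branch_iff)

lemma branch_size_off_branch: "v \<in> V - B - {r} \<Longrightarrow> branch_size T r v = branch_size T2 r v"
  by (simp add: branch_size_def dsc_off_branch_iff)

end

text \<open>For a tree on \<open>V\<close> this means that labels increase along every path from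
  \<open>Min V\<close>; stated by neighbours, it can be tested on the parts of a glued tree.\<close>

definition increasing :: "nat set \<Rightarrow> nat set set \<Rightarrow> bool" where
  "increasing V T \<longleftrightarrow> (\<forall>v\<in>V - {Min V}. \<exists>u<v. {u, v} \<in> T)"

text \<open>The least vertex of \<open>B\<close> has its smaller neighbour outside \<open>B\<close>,
  and the only edge out of \<open>B\<close> is \<open>{r, c}\<close>; hence
  \<open>c = Min B\<close>. Every other vertex except \<open>r\<close> finds its smaller neighbour
  in its own part.\<close>

lemma increasing_glue:
  assumes "glued_tree V B r c T1 T2" and V: "finite V" and root: "r = Min V"
  shows "increasing V (insert {r, c} (T1 \<union> T2)) \<longleftrightarrow>
    c = Min B \<and> increasing B T1 \<and> increasing (V - B) T2"
    and "Min (V - B) = r" and "\<And>b. b \<in> B \<Longrightarrow> r < b"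
proof -
  interpret glued_tree V B r c T1 T2
    by fact
  have finB: "finite B" "B \<noteq> {}"
    using B V c by (auto intro: finite_subset[of B V])
  have le: "r \<le> v" if "v \<in> V" for v
    using V that by (simp add: root)
  show minV: "Min (V - B) = r"
    using V rB le by (intro Min_eqI) auto
  show rb: "r < b" if "b \<in> B" for b
    using le[of b] B that by (auto simp: le_less)
  show "increasing V T \<longleftrightarrow> c = Min B \<and> increasing B T1 \<and> increasing (V - B) T2"
  proof
    assume inc: "increasing V T"
    have "Min B \<in> B"
      using finB by simp
    then obtain u where u: "u < Min B" "{u, Min B} \<in> T"
      using inc B unfolding increasing_def root[symmetric] by blast
    have "u \<notin> B"
      using u finB by (meson Min_le not_le)
    then have "{u, Min B} \<notin> T1" "{u, Min B} \<notin> T2"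
      using T1 T2 \<open>Min B \<in> B\<close> by auto
    then have cM: "c = Min B"
      using u \<open>Min B \<in> B\<close> rB by (auto simp: doubleton_eq_iff)
    have "\<exists>u<v. {u, v} \<in> T1" if v: "v \<in> B - {Min B}" for v
    proof -
      obtain u where u: "u < v" "{u, v} \<in> T"
        using inc B v unfolding increasing_def root[symmetric] by blast
      then have "{u, v} \<in> T1"
        using v cM T2 rB by (auto simp: doubleton_eq_iff)
      then show ?thesis
        using u by blast
    qed
    moreover have "\<exists>u<v. {u, v} \<in> T2" if v: "v \<in> V - B - {r}" for v
    proof -
      obtain u where u: "u < v" "{u, v} \<in> T"
        using inc v unfolding increasing_def root[symmetric] by blast
      then have "{u, v} \<in> T2"
        using v c T1 by (auto simp: doubleton_eq_iff)
      then show ?thesis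
        using u by blast
    qed
    ultimately show "c = Min B \<and> increasing B T1 \<and> increasing (V - B) T2"
      using cM minV by (auto simp: increasing_def)
  next
    assume *: "c = Min B \<and> increasing B T1 \<and> increasing (V - B) T2"
    show "increasing V T"
      unfolding increasing_def root[symmetric]
    proof
      fix v assume v: "v \<in> V - {r}"
      consider "v = c" | "v \<in> B - {Min B}" | "v \<in> V - B - {r}"
        using v * by blast
      then show "\<exists>u<v. {u, v} \<in> T"
      proof cases
        case 1
        then show ?thesis
          using rb[OF c] by blast
      next
        case 2
        then show ?thesis
          using * by (auto simp: increasing_def)
      next
        case 3
        then show ?thesis
          using * minV by (auto simp: increasing_def)
      qed
    qed
  qed
qed

text \<open>The weight at \<open>t = 1\<close> of the flow carried by an increasing tree: the factor
  of \<open>v\<close> belongs to the edge from \<open>v\<close> to its parent. The value 0 for other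
  trees lets sums range over all of \<open>trees V\<close>.\<close>

definition inc_weight :: "'r::comm_ring_1 \<Rightarrow> nat set \<Rightarrow> nat set set \<Rightarrow> 'r" where
  "inc_weight q V T =
     (if increasing V T then \<Prod>v\<in>V - {Min V}. qint q (branch_size T (Min V) v) else 0)"

text \<open>Gluing changes no branch size of a vertex other than \<open>r\<close>. Only the factor
  of \<open>c\<close> is new, as \<open>c\<close> is no longer the root, and its branch is all of
  \<open>B\<close>.\<close>

lemma inc_weight_glue:
  assumes glue: "glued_tree V B r c T1 T2" and V: "finite V" and root: "r = Min V"
  shows "inc_weight q V (insert {r, c} (T1 \<union> T2)) =
    (if c = Min B then qint q (card B) else 0) * inc_weight q B T1 * inc_weight q (V - B) T2"
proof -
  interpret glued_tree V B r c T1 T2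
    by fact
  note inc = increasing_glue[OF assms]
  show ?thesis
  proof (cases "increasing V T")
    case True
    then have *: "c = Min B" "increasing B T1" "increasing (V - B) T2"
      using inc(1) by auto
    have fin: "finite B" "finite (V - B)"
      using B V by (auto intro: finite_subset[of B V])
    let ?f = "\<lambda>v. qint q (branch_size T r v)"
    have "V - {r} = insert c ((B - {c}) \<union> (V - B - {r}))"
      using B c rB by auto
    moreover have "c \<notin> (B - {c}) \<union> (V - B - {r})"
      using c by auto
    ultimately have "(\<Prod>v\<in>V - {r}. ?f v) = ?f c * ((\<Prod>v\<in>B - {c}. ?f v) * (\<Prod>v\<in>V - B - {r}. ?f v))"
      using fin by (simp only: prod.insert finite_Un finite_Diff simp_thms)
        (subst prod.union_disjoint; auto)
    moreover have "?f c = qint q (card B)"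
      using branch_size_branch[OF c] branch_size_root[OF T1(2,1) c] by simp
    moreover have "(\<Prod>v\<in>B - {c}. ?f v) = inc_weight q B T1"
      using * branch_size_branch by (auto simp: inc_weight_def intro!: prod.cong)
    moreover have "(\<Prod>v\<in>V - B - {r}. ?f v) = inc_weight q (V - B) T2"
      using *(3) inc(2) branch_size_off_branch by (auto simp: inc_weight_def intro!: prod.cong)
    ultimately show ?thesis
      using True *(1) by (simp add: inc_weight_def root[symmetric] mult.assoc)
  next
    case False
    then show ?thesis
      using inc(1) by (auto simp: inc_weight_def)
  qed
qed

context shifted_graph
begin

text \<open>The vertex \<open>x\<close> has a neighbour \<open>b\<close> in \<open>B\<close>, and
  the smaller vertex \<open>r\<close> can take the place of \<open>b\<close>.\<close>

lemma star_full:
  assumes A: "A \<in> conn_subs B" and r: "\<And>b. b \<in> B \<Longrightarrow> r < b" and B: "B \<noteq> {x}" and x: "x \<in> B"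
  shows "{r, x} \<in> E"
proof -
  have "conn B A"
    using A by (simp add: conn_subs_def)
  then obtain a b where "a \<in> {x}" "b \<in> B - {x}" "{a, b} \<in> A"
    using B x by (metis conn_cut empty_subsetI insert_not_empty insert_subset)
  then have "{b, x} \<in> E" "r < b"
    using A r by (auto simp: conn_subs_def insert_commute)
  then show ?thesis
    using shifted[of b x r] r[OF x] by auto
qed

text \<open>The recursion of \<open>conn_enum\<close> with \<open>r = Min V\<close>. Only
  \<open>c = Min B\<close> contributes, and it does so with the \<open>q\<close>-integer of
  \<open>card B\<close> in place of that of the number of neighbours of \<open>r\<close> in
  \<open>B\<close>.\<close>

lemma sum_inc_weight:
  fixes q :: "'r::comm_ring_1"
  assumes "finite V" "V \<noteq> {}"
  shows "(\<Sum>T\<in>trees V. inc_weight q V T) = conn_enum q V"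
  using assms
proof (induction "card V" arbitrary: V rule: less_induct)
  case less
  define r where "r = Min V"
  have r: "r \<in> V"
    using less.prems by (simp add: r_def)
  show ?case
  proof (cases "V = {r}")
    case True
    have "inc_weight q {r} {} = 1"
      by (simp add: inc_weight_def increasing_def)
    then show ?thesis
      by (subst True, subst (2) True) (simp add: trees_singleton True)
  next
    case False
    then obtain v where v: "v \<in> V - {r}"
      using r by blast
    have IH: "(\<Sum>T\<in>trees B. inc_weight q B T) = conn_enum q B" if "B \<subset> V" "B \<noteq> {}" for B
      using less.hyps[OF psubset_card_mono[OF less.prems(1) that(1)] _ that(2)] that less.prems(1)
      by (meson finite_subset psubset_imp_subset)
    have "(\<Sum>T\<in>trees V. inc_weight q V T) = (\<Sum>B | v \<in> B \<and> B \<subseteq> V - {r}.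
      (\<Sum>c | c \<in> B \<and> {r, c} \<in> E. (if c = Min B then qint q (card B) else 0)
          * (\<Sum>T\<in>trees B. inc_weight q B T))
        * (\<Sum>T\<in>trees (V - B). inc_weight q (V - B) T))"
    proof (intro sum_trees_rec less.prems r v)
      fix B c T1 T2
      assume "B \<subseteq> V - {r}" "c \<in> B" "T1 \<in> trees B" "T2 \<in> trees (V - B)"
      then have "glued_tree V B r c T1 T2"
        by (intro glued_treeI r)
      from inc_weight_glue[OF this less.prems(1) r_def]
      show "inc_weight q V (insert {r, c} (T1 \<union> T2)) =
        (if c = Min B then qint q (card B) else 0) * inc_weight q B T1 * inc_weight q (V - B) T2" .
    qed
    also have "\<dots> = (\<Sum>B | v \<in> B \<and> B \<subseteq> V - {r}.
      qint q (card {b \<in> B. {r, b} \<in> E}) * conn_enum q B * conn_enum q (V - B))"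
    proof (intro sum.cong refl)
      fix B assume "B \<in> {B. v \<in> B \<and> B \<subseteq> V - {r}}"
      then have B: "B \<subset> V" "V - B \<subset> V" "V - B \<noteq> {}" "B \<noteq> {}" "B \<subseteq> V - {r}"
        using r by auto
      have fin: "finite B"
        using B less.prems(1) by (meson finite_subset psubset_imp_subset)
      have rb: "r < b" if "b \<in> B" for b
      proof -
        have "r \<le> b"
          using that B less.prems(1) by (auto simp: r_def)
        then show ?thesis
          using that B by (auto simp: le_less)
      qed
      let ?N = "{b \<in> B. {r, b} \<in> E}"
      have "(\<Sum>c\<in>?N. if c = Min B then qint q (card B) else 0)
        = (if Min B \<in> ?N then qint q (card B) else 0)"
        using fin by (subst sum.delta) auto
      \<comment> \<open>The two factors agree unless \<open>conn_enum q B\<close> vanishes: a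
        connected \<open>B\<close> with at least two elements consists of neighbours of
        \<open>r\<close>, and for a singleton both are decided by one edge.\<close>
      moreover have "(if Min B \<in> ?N then qint q (card B) else 0) * conn_enum q B
        = qint q (card ?N) * conn_enum q B"
      proof (cases "conn_subs B = {}")
        case True
        then show ?thesis
          by (simp add: conn_enum_def)
      next
        case False
        then obtain A where A: "A \<in> conn_subs B"
          by blast
        show ?thesis
        proof (cases "B = {Min B}")
          case True
          then obtain m where "B = {m}" "Min B = m"
            by blast
          then show ?thesis
            by (cases "{r, m} \<in> E") (auto simp: Collect_conv_if)
        next
          case False
          have "x \<in> ?N" if x: "x \<in> B" for x
          proof -
            have "B \<noteq> {x}"
              using False by auto
            then show ?thesis
              using star_full[OF A rb _ x] x by simp
          qed
          then have "?N = B"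
            by blast
          then show ?thesis
            using fin B(4) by simp
        qed
      qed
      ultimately show "(\<Sum>c | c \<in> B \<and> {r, c} \<in> E. (if c = Min B then qint q (card B) else 0)
          * (\<Sum>T\<in>trees B. inc_weight q B T))
        * (\<Sum>T\<in>trees (V - B). inc_weight q (V - B) T)
        = qint q (card ?N) * conn_enum q B * conn_enum q (V - B)"
        unfolding IH[OF B(1,4)] IH[OF B(2,3)] sum_distrib_right[symmetric] by (simp only:)
    qed
    also have "\<dots> = conn_enum q V"
      by (rule conn_enum_rec[OF less.prems(1) r v, symmetric])
    finally show ?thesis .
  qed
qed

end

context nat_graph
begin

text \<open>In an increasing tree the children of \<open>v\<close> are its neighbours above
  \<open>v\<close>. The induction follows the split at the least vertex, where the branch of
  \<open>c\<close> is all of \<open>B\<close>.\<close>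

lemma branch_size_rec:
  assumes "finite V" "T \<in> trees V" "increasing V T" "v \<in> V"
  shows "branch_size T (Min V) v = 1 + (\<Sum>u | u \<in> V \<and> v < u \<and> {u, v} \<in> T. branch_size T (Min V) u)"
  using assms
proof (induction "card V" arbitrary: V T v rule: less_induct)
  case less
  define r where "r = Min V"
  have r: "r \<in> V"
    using less.prems by (auto simp: r_def intro: Min_in)
  have TV: "conn V T" "T \<subseteq> Pow V"
    using less.prems(2) by (auto simp: trees_def conn_subs_def)
  show ?case
  proof (cases "V = {r}")
    case True
    then have "v = r" "{u. u \<in> V \<and> v < u \<and> {u, v} \<in> T} = {}"
      using less.prems(4) by auto
    then show ?thesis
      using branch_size_root[OF TV r] True by (simp add: r_def[symmetric])
  next
    case False
    then obtain w where w: "w \<in> V - {r}"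
      using r by blast
    obtain B c T1 T2 where BV: "B \<subseteq> V - {r}" "c \<in> B" "T1 \<in> trees B" "T2 \<in> trees (V - B)"
      and T: "T = insert {r, c} (T1 \<union> T2)"
      using less.prems(2) unfolding bij_betw_imp_surj_on[OF bij_betw_trees[OF less.prems(1) r w], symmetric]
      by auto
    have glue: "glued_tree V B r c T1 T2"
      using BV r by (intro glued_treeI)
    interpret glued_tree V B r c T1 T2
      by (rule glue)
    note ig = increasing_glue[OF glue less.prems(1) r_def]
    have inc: "c = Min B" "increasing B T1" "increasing (V - B) T2"
      using ig(1) less.prems(3) T by auto
    have psub: "B \<subset> V" "V - B \<subset> V"
      using BV r by auto
    have fin: "finite B" "finite (V - B)"
      using less.prems(1) psub finite_subset[of B V] by auto
    have IH1: "branch_size T1 c x = 1 + (\<Sum>u | u \<in> B \<and> x < u \<and> {u, x} \<in> T1. branch_size T1 c u)"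
      if "x \<in> B" for x
      using less.hyps[OF psubset_card_mono[OF less.prems(1) psub(1)] fin(1) BV(3) inc(2) that] inc(1)
      by simp
    have IH2: "branch_size T2 r x = 1 + (\<Sum>u | u \<in> V - B \<and> x < u \<and> {u, x} \<in> T2. branch_size T2 r u)"
      if "x \<in> V - B" for x
      using less.hyps[OF psubset_card_mono[OF less.prems(1) psub(2)] fin(2) BV(4) inc(3) that] ig(2)
      by simp
    let ?U = "{u. u \<in> V \<and> v < u \<and> {u, v} \<in> T}"
    consider "v = r" | "v \<in> B" | "v \<in> V - B - {r}"
      using less.prems(4) by blast
    then have "branch_size T r v = 1 + (\<Sum>u\<in>?U. branch_size T r u)"
    proof cases
      case 1
      let ?U2 = "{u. u \<in> V - B \<and> r < u \<and> {u, r} \<in> T2}"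
      have U: "?U = insert c ?U2" "c \<notin> ?U2"
        using 1 ig(3)[OF BV(2)] BV T1(1) T2(1) rB
        by (auto simp: T insert_commute doubleton_eq_iff)
      have "(\<Sum>u\<in>?U. branch_size T r u) = branch_size T r c + (\<Sum>u\<in>?U2. branch_size T r u)"
        unfolding U(1) using U(2) less.prems(1) by (intro sum.insert) auto
      also have "branch_size T r c = card B"
        using branch_size_branch[OF c] branch_size_root[OF T1(2,1) c] by (simp add: T)
      also have "(\<Sum>u\<in>?U2. branch_size T r u) = (\<Sum>u\<in>?U2. branch_size T2 r u)"
        using branch_size_off_branch by (intro sum.cong refl) (auto simp: T)
      also have "1 + (card B + (\<Sum>u\<in>?U2. branch_size T2 r u)) = card B + card (V - B)"
        using IH2[OF rB] branch_size_root[OF T2(2,1) rB] by simp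
      also have "\<dots> = branch_size T r r"
        using branch_size_root[OF TV r] card_split[OF less.prems(1) psubset_imp_subset[OF psub(1)]]
        by simp
      finally show ?thesis
        using 1 by simp
    next
      case 2
      have "?U = {u. u \<in> B \<and> v < u \<and> {u, v} \<in> T1}"
        using 2 ig(3)[OF 2] BV T1(1) T2(1) rB by (auto simp: T doubleton_eq_iff)
      then show ?thesis
        using IH1[OF 2] branch_size_branch 2 by (simp add: T)
    next
      case 3
      have "?U = {u. u \<in> V - B \<and> v < u \<and> {u, v} \<in> T2}"
        using 3 BV T1(1) T2(1) by (auto simp: T doubleton_eq_iff)
      moreover have "r < u" if "v < u" for u
        using that Min_le[OF less.prems(1,4)] unfolding r_def by linarith
      ultimately have "(\<Sum>u\<in>?U. branch_size T r u)
          = (\<Sum>u | u \<in> V - B \<and> v < u \<and> {u, v} \<in> T2. branch_size T2 r u)"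
        using branch_size_off_branch by (intro sum.cong) (auto simp: T)
      then show ?thesis
        using IH2[of v] branch_size_off_branch[of v] 3 by (simp add: T)
    qed
    then show ?thesis
      by (simp add: r_def)
  qed
qed

end

section \<open>Flows at \<open>t = 1\<close>\<close>

text \<open>The nonzero factor \<open>q - 1\<close> is cancelled from \<open>wt_exact\<close> at
  \<open>t = 1\<close>. The case \<open>b = 0\<close> is separate, because \<open>wt 0\<close> is 1
  while \<open>qint\<close> vanishes at 0.\<close>

lemma poly_wt: "poly (wt b) 1 = (if b = 0 then 1 else qint qvar b)"
proof (cases "b = 0")
  case False
  have "poly (wt b * (q2 - t2)) 1 = poly (q2 ^ b - t2 ^ b) 1"
    using False wt_exact[of b] by simp
  then have "poly (wt b) 1 * (qvar - 1) = qvar ^ b - 1"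
    by (simp add: q2_def t2_def poly_power algebra_simps)
  also have "\<dots> = qint qvar b * (qvar - 1)"
    by (simp add: power_diff_1_eq qint_def mult.commute)
  finally have "poly (wt b) 1 * (qvar - 1) = qint qvar b * (qvar - 1)" .
  moreover have "qvar - 1 \<noteq> 0"
    by (simp add: qvar_def one_pCons)
  ultimately show ?thesis
    using False by simp
qed (simp add: wt_def)

definition support :: "nat set set \<Rightarrow> (nat \<times> nat \<Rightarrow> real) \<Rightarrow> (nat \<times> nat) set" where
  "support E x = {e \<in> dedges E. x e > 0}"

text \<open>At \<open>t = 1\<close> the base of the power in \<open>wt_flow\<close> is 0, so only
  flows with exponent 0, that is, with exactly \<open>n\<close> edges in their support,
  survive.\<close>

lemma poly_wt_flow:
  assumes E: "\<forall>e\<in>E. e \<subseteq> {0..n}" and x: "x \<in> lattice_flows n E a" and n: "n \<le> card (support E x)"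
  shows "poly (wt_flow n E x) 1 =
    (if card (support E x) = n then \<Prod>e\<in>support E x. qint qvar (nat \<lfloor>x e\<rfloor>) else 0)"
proof -
  have fin: "finite (dedges E)"
    using dedges_subset[OF E] by (rule finite_subset) simp
  have x0: "x e \<ge> 0" "x e \<in> \<int>" if "e \<in> dedges E" for e
    using x that by (cases e; auto simp: lattice_flows_def flow_polytope_def PiE_def Pi_def)+
  have "poly (\<Prod>e\<in>dedges E. wt (nat \<lfloor>x e\<rfloor>)) 1 = (\<Prod>e\<in>dedges E. poly (wt (nat \<lfloor>x e\<rfloor>)) 1)"
    by (rule poly_prod)
  also have "\<dots> = (\<Prod>e\<in>support E x. qint qvar (nat \<lfloor>x e\<rfloor>))"
  proof (rule prod.mono_neutral_cong_right[OF fin])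
    show "\<forall>e\<in>dedges E - support E x. poly (wt (nat \<lfloor>x e\<rfloor>)) 1 = 1"
    proof
      fix e assume "e \<in> dedges E - support E x"
      then have "x e = 0"
        using x0[of e] by (auto simp: support_def)
      then show "poly (wt (nat \<lfloor>x e\<rfloor>)) 1 = 1"
        by (simp add: poly_wt)
    qed
    fix e assume e: "e \<in> support E x"
    then obtain z where "x e = of_int z"
      using x0(2)[of e] by (auto simp: support_def elim: Ints_cases)
    then have "nat \<lfloor>x e\<rfloor> \<noteq> 0"
      using e by (auto simp: support_def)
    then show "poly (wt (nat \<lfloor>x e\<rfloor>)) 1 = qint qvar (nat \<lfloor>x e\<rfloor>)"
      by (simp add: poly_wt)
  qed (auto simp: support_def)
  finally have "poly (wt_flow n E x) 1
      = 0 ^ (card (support E x) - n) * (\<Prod>e\<in>support E x. qint qvar (nat \<lfloor>x e\<rfloor>))"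
    by (simp add: wt_flow_def support_def[symmetric] poly_power t2_def)
  then show ?thesis
    using n by (auto simp: power_0_left)
qed

lemma netflow_parent:
  assumes fin: "finite (dedges E)" and x: "\<And>e. e \<in> dedges E \<Longrightarrow> x e \<ge> 0"
    and supp: "support E x = (\<lambda>v. (v, f v)) ` {1..n}"
  shows "(\<Sum>e\<in>dedges E. incidence v e * x e) =
    (if v \<in> {1..n} then x (v, f v) else 0) - (\<Sum>u | u \<in> {1..n} \<and> f u = v. x (u, f u))"
proof -
  have "(\<Sum>e\<in>dedges E. incidence v e * x e) = (\<Sum>e\<in>support E x. incidence v e * x e)"
    using x by (intro sum.mono_neutral_right[OF fin]) (force simp: support_def)+
  also have "\<dots> = (\<Sum>u\<in>{1..n}. incidence v (u, f u) * x (u, f u))"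
    unfolding supp by (subst sum.reindex) (auto simp: inj_on_def)
  also have "\<dots> = (\<Sum>u\<in>{1..n}. (if v = u then x (u, f u) else 0) - (if f u = v then x (u, f u) else 0))"
    by (intro sum.cong refl) (auto simp: incidence_def)
  also have "\<dots> = (if v \<in> {1..n} then x (v, f v) else 0) - (\<Sum>u | u \<in> {1..n} \<and> f u = v. x (u, f u))"
    by (simp add: sum_subtractf sum.inter_filter[symmetric])
  finally show ?thesis .
qed

section \<open>Increasing trees given by parent functions\<close>

definition parent_edges :: "nat \<Rightarrow> (nat \<Rightarrow> nat) \<Rightarrow> nat set set" where
  "parent_edges n f = (\<lambda>v. {v, f v}) ` {1..n}"

lemma Min_interval: "Min {0..n::nat} = 0"
  by (rule Min_eqI) auto

context
  fixes n :: nat and f :: "nat \<Rightarrow> nat"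
  assumes parent: "\<And>v. v \<in> {1..n} \<Longrightarrow> f v < v"
begin

lemma parent_edges_iff: "v < u \<Longrightarrow> {u, v} \<in> parent_edges n f \<longleftrightarrow> u \<in> {1..n} \<and> f u = v"
  using parent by (fastforce simp: parent_edges_def doubleton_eq_iff)

lemma card_parent_edges: "card (parent_edges n f) = n"
proof -
  have "inj_on (\<lambda>v. {v, f v}) {1..n}"
  proof (rule inj_onI)
    fix u v assume u: "u \<in> {1..n}" and v: "v \<in> {1..n}" and eq: "{u, f u} = {v, f v}"
    then show "u = v"
      using parent[OF u] parent[OF v] by (auto simp: doubleton_eq_iff)
  qed
  then show ?thesis
    by (simp add: parent_edges_def card_image)
qed

lemma increasing_parent_edges: "increasing {0..n} (parent_edges n f)"
  unfolding increasing_def Min_interval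
proof
  fix v assume "v \<in> {0..n} - {0}"
  then have v: "v \<in> {1..n}"
    by auto
  then have "{f v, v} \<in> parent_edges n f"
    by (auto simp: parent_edges_def insert_commute)
  then show "\<exists>u<v. {u, v} \<in> parent_edges n f"
    using parent[OF v] by blast
qed

text \<open>The least element of a nonempty set avoiding 0 has its parent outside the set.\<close>

lemma conn_parent_edges: "conn {0..n} (parent_edges n f)"
proof -
  have "\<exists>a\<in>S. \<exists>b\<in>{0..n} - S. {a, b} \<in> parent_edges n f" if S: "S \<subseteq> {0..n} - {0}" "S \<noteq> {}" for S
  proof -
    have fin: "finite S"
      using S by (meson finite_Diff finite_atLeastAtMost finite_subset)
    have m: "Min S \<in> S" "Min S \<in> {1..n}"
      using Min_in[OF fin S(2)] S(1) by auto
    moreover have "f (Min S) \<notin> S"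
      using parent[OF m(2)] fin by (meson Min_le not_le)
    moreover have "f (Min S) \<in> {0..n}"
      using parent[OF m(2)] m(2) by auto
    ultimately show ?thesis
      by (intro bexI[of _ "Min S"] bexI[of _ "f (Min S)"]) (auto simp: parent_edges_def)
  qed
  then show ?thesis
    by (subst conn_root[of 0]) auto
qed

end

context nat_graph
begin

lemma parent_edges_trees:
  assumes f: "\<And>v. v \<in> {1..n} \<Longrightarrow> f v < v" and E: "\<And>v. v \<in> {1..n} \<Longrightarrow> {v, f v} \<in> E"
  shows "parent_edges n f \<in> trees {0..n}"
proof -
  have "f v \<le> n" if "v \<in> {1..n}" for v
    using f[OF that] that by auto
  then have "parent_edges n f \<subseteq> Pow {0..n}" "parent_edges n f \<subseteq> E"
    using E by (auto simp: parent_edges_def)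
  then show ?thesis
    using conn_parent_edges[OF f] card_parent_edges[OF f] by (simp add: trees_def conn_subs_def)
qed

text \<open>Choosing a smaller neighbour of every positive vertex yields \<open>n\<close> distinct
  edges, and the tree has no more than these.\<close>

lemma increasing_tree_parent:
  assumes T: "T \<in> trees {0..n}" and inc: "increasing {0..n} T"
  obtains f where "\<And>v. v \<in> {1..n} \<Longrightarrow> f v < v" "T = parent_edges n f"
proof -
  have "\<forall>v\<in>{1..n}. \<exists>u<v. {u, v} \<in> T"
    using inc by (auto simp: increasing_def Min_interval)
  then obtain f where f: "\<And>v. v \<in> {1..n} \<Longrightarrow> f v < v" and fT: "\<And>v. v \<in> {1..n} \<Longrightarrow> {f v, v} \<in> T"
    by metis
  have "parent_edges n f \<subseteq> T"
    using fT by (auto simp: parent_edges_def insert_commute)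
  moreover have "finite T" "card T = n"
    using T conn_subs_finite[of T "{0..n}"] by (auto simp: trees_def)
  ultimately have "parent_edges n f = T"
    using card_parent_edges[OF f] by (intro card_subset_eq) auto
  then show ?thesis
    using that f by blast
qed

lemma branch_size_parent:
  assumes f: "\<And>v. v \<in> {1..n} \<Longrightarrow> f v < v" and T: "parent_edges n f \<in> trees {0..n}" and v: "v \<in> {0..n}"
  shows "branch_size (parent_edges n f) 0 v
    = 1 + (\<Sum>u | u \<in> {1..n} \<and> f u = v. branch_size (parent_edges n f) 0 u)"
proof -
  have "{u. u \<in> {0..n} \<and> v < u \<and> {u, v} \<in> parent_edges n f} = {u. u \<in> {1..n} \<and> f u = v}"
  proof (intro Collect_cong iffI)
    fix u assume "u \<in> {0..n} \<and> v < u \<and> {u, v} \<in> parent_edges n f"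
    then show "u \<in> {1..n} \<and> f u = v"
      using parent_edges_iff[of n f v u] f by auto
  next
    fix u assume u: "u \<in> {1..n} \<and> f u = v"
    then show "u \<in> {0..n} \<and> v < u \<and> {u, v} \<in> parent_edges n f"
      using f[of u] by (auto simp: parent_edges_def)
  qed
  then show ?thesis
    using branch_size_rec[OF _ T increasing_parent_edges[OF f] v] by (simp add: Min_interval)
qed

end

section \<open>Flows supported on the edges of an increasing tree\<close>

definition unit_netflow :: "nat \<Rightarrow> nat \<Rightarrow> int" where
  "unit_netflow n = (\<lambda>i. if i = 0 then - int n else 1)"

text \<open>Each vertex of the branch above \<open>v\<close> feeds in one unit, and all of it must
  pass through the edge from \<open>v\<close> to its parent.\<close>

definition tree_flow :: "nat set set \<Rightarrow> nat set set \<Rightarrow> nat \<times> nat \<Rightarrow> real" where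
  "tree_flow E T = (\<lambda>e\<in>dedges E. if {fst e, snd e} \<in> T then real (branch_size T 0 (fst e)) else 0)"

definition support_tree :: "nat set set \<Rightarrow> (nat \<times> nat \<Rightarrow> real) \<Rightarrow> nat set set" where
  "support_tree E x = (\<lambda>(i, j). {i, j}) ` support E x"

lemma support_tree_parent:
  "support E x = (\<lambda>v. (v, f v)) ` {1..n} \<Longrightarrow> support_tree E x = parent_edges n f"
  by (auto simp: support_tree_def parent_edges_def)

text \<open>Positive netflow at \<open>v\<close> forces an edge of the support to start at
  \<open>v\<close>. With \<open>n\<close> edges for \<open>n\<close> vertices there is exactly one
  for each.\<close>

lemma flow_support_parent:
  assumes fin: "finite (dedges E)" and x: "x \<in> flow_polytope n E a" and a: "\<And>v. v \<in> {1..n} \<Longrightarrow> a v > 0"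
    and card: "card (support E x) = n"
  obtains f where "\<And>v. v \<in> {1..n} \<Longrightarrow> f v < v" "\<And>v. v \<in> {1..n} \<Longrightarrow> {v, f v} \<in> E"
    "support E x = (\<lambda>v. (v, f v)) ` {1..n}"
proof -
  have nonneg: "x e \<ge> 0" if "e \<in> dedges E" for e
    using x that by (cases e) (auto simp: flow_polytope_def PiE_def Pi_def)
  have "\<exists>w. (v, w) \<in> support E x" if v: "v \<in> {1..n}" for v
  proof (rule ccontr)
    assume *: "\<nexists>w. (v, w) \<in> support E x"
    have "(\<Sum>e\<in>dedges E. incidence v e * x e) \<le> 0"
    proof (rule sum_nonpos)
      fix e assume e: "e \<in> dedges E"
      show "incidence v e * x e \<le> 0"
      proof (cases "fst e = v")
        case True
        then have "\<not> x e > 0"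
          using * e by (cases e) (auto simp: support_def)
        then show ?thesis
          using nonneg[OF e] by simp
      next
        case False
        then show ?thesis
          using nonneg[OF e] by (simp add: incidence_def)
      qed
    qed
    moreover have "(\<Sum>e\<in>dedges E. incidence v e * x e) = of_int (a v)"
      using x v by (simp add: flow_polytope_def)
    ultimately show False
      using a[OF v] by linarith
  qed
  then obtain f where f: "\<And>v. v \<in> {1..n} \<Longrightarrow> (v, f v) \<in> support E x"
    by metis
  have "card ((\<lambda>v. (v, f v)) ` {1..n}) = n"
    by (subst card_image) (auto simp: inj_on_def)
  moreover have "finite (support E x)"
    using fin by (auto simp: support_def)
  ultimately have "(\<lambda>v. (v, f v)) ` {1..n} = support E x"
    using f card by (intro card_subset_eq) auto
  moreover have "f v < v" "{v, f v} \<in> E" if "v \<in> {1..n}" for v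
    using f[OF that] by (auto simp: support_def dedges_def)
  ultimately show ?thesis
    using that by metis
qed

context nat_graph
begin

text \<open>Conservation at \<open>v\<close> says that the flow out of \<open>v\<close> is 1 plus
  the flows from its children, which is the recursion of the branch sizes. Children have larger
  labels, so the values are determined downwards from \<open>n\<close>.\<close>

lemma flow_eq_tree_flow:
  assumes E: "E \<subseteq> Pow {0..n}" and x: "x \<in> flow_polytope n E (unit_netflow n)"
    and f: "\<And>v. v \<in> {1..n} \<Longrightarrow> f v < v" and fE: "\<And>v. v \<in> {1..n} \<Longrightarrow> {v, f v} \<in> E"
    and supp: "support E x = (\<lambda>v. (v, f v)) ` {1..n}"
  shows "\<And>v. v \<in> {1..n} \<Longrightarrow> x (v, f v) = real (branch_size (parent_edges n f) 0 v)"
    and "x = tree_flow E (parent_edges n f)"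
proof -
  let ?T = "parent_edges n f"
  have fin: "finite (dedges E)"
    using dedges_subset[of E n] E by (auto intro: finite_subset[of "dedges E" "{0..n} \<times> {0..n}"])
  have nonneg: "x e \<ge> 0" if "e \<in> dedges E" for e
    using x that by (cases e) (auto simp: flow_polytope_def PiE_def Pi_def)
  have T: "?T \<in> trees {0..n}"
    by (rule parent_edges_trees[OF f fE])
  show val: "x (v, f v) = real (branch_size ?T 0 v)" if "v \<in> {1..n}" for v
    using that
  proof (induction "n - v" arbitrary: v rule: less_induct)
    case less
    have "(\<Sum>e\<in>dedges E. incidence v e * x e) = 1"
      using x less.prems by (auto simp: flow_polytope_def unit_netflow_def)
    then have "x (v, f v) = 1 + (\<Sum>u | u \<in> {1..n} \<and> f u = v. x (u, f u))"
      using netflow_parent[OF fin nonneg supp, of v] less.prems by simp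
    also have "(\<Sum>u | u \<in> {1..n} \<and> f u = v. x (u, f u))
        = (\<Sum>u | u \<in> {1..n} \<and> f u = v. real (branch_size ?T 0 u))"
    proof (intro sum.cong refl)
      fix u assume u: "u \<in> {u. u \<in> {1..n} \<and> f u = v}"
      then show "x (u, f u) = real (branch_size ?T 0 u)"
        using f[of u] by (intro less.hyps) auto
    qed
    also have "1 + \<dots> = real (branch_size ?T 0 v)"
      using branch_size_parent[OF f T, of v] less.prems by simp
    finally show ?case .
  qed
  show "x = tree_flow E ?T"
  proof
    fix e
    show "x e = tree_flow E ?T e"
    proof (cases "e \<in> dedges E")
      case False
      then show ?thesis
        using x PiE_arb[of x "dedges E" "\<lambda>_. {0..}"] by (simp add: tree_flow_def flow_polytope_def)
    next
      case True
      obtain i j where e: "e = (i, j)"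
        by (cases e)
      have "j < i"
        using True e by (simp add: dedges_def)
      then have iff: "{i, j} \<in> ?T \<longleftrightarrow> i \<in> {1..n} \<and> f i = j"
        by (intro parent_edges_iff f)
      show ?thesis
      proof (cases "{i, j} \<in> ?T")
        case T: True
        then have "i \<in> {1..n}" "f i = j"
          using iff by auto
        then show ?thesis
          using True T val[of i] by (simp add: e tree_flow_def)
      next
        case F: False
        then have "e \<notin> support E x"
          using iff unfolding supp e by auto
        then have "x e = 0"
          using True nonneg[of e] by (auto simp: support_def)
        then show ?thesis
          using True F by (simp add: e tree_flow_def)
      qed
    qed
  qed
qed

lemma tree_flow:
  assumes E: "E \<subseteq> Pow {0..n}" and f: "\<And>v. v \<in> {1..n} \<Longrightarrow> f v < v"
    and T: "parent_edges n f \<in> trees {0..n}"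
  shows "support E (tree_flow E (parent_edges n f)) = (\<lambda>v. (v, f v)) ` {1..n}"
    and "tree_flow E (parent_edges n f) \<in> lattice_flows n E (unit_netflow n)"
proof -
  let ?T = "parent_edges n f" and ?x = "tree_flow E (parent_edges n f)"
  have fin: "finite (dedges E)"
    using dedges_subset[of E n] E by (auto intro: finite_subset[of "dedges E" "{0..n} \<times> {0..n}"])
  have TE: "?T \<subseteq> E" "?T \<subseteq> Pow {0..n}" "conn {0..n} ?T"
    using T by (auto simp: trees_def conn_subs_def)
  have fd: "(v, f v) \<in> dedges E" "{v, f v} \<in> ?T" if "v \<in> {1..n}" for v
    using f[OF that] TE(1) that by (auto simp: dedges_def parent_edges_def)
  have pos: "branch_size ?T 0 v > 0" if "v \<in> {0..n}" for v
    using branch_size_parent[OF f T that] by simp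
  have nonneg: "?x e \<ge> 0" if "e \<in> dedges E" for e
    using that by (auto simp: tree_flow_def)
  show supp: "support E ?x = (\<lambda>v. (v, f v)) ` {1..n}"
  proof (intro equalityI subsetI)
    fix e assume e: "e \<in> support E ?x"
    obtain i j where ij: "e = (i, j)"
      by (cases e)
    have "j < i" "{i, j} \<in> ?T"
      using e ij by (auto simp: support_def tree_flow_def dedges_def split: if_splits)
    then have "i \<in> {1..n}" "f i = j"
      using parent_edges_iff[of n f j i] f by auto
    then show "e \<in> (\<lambda>v. (v, f v)) ` {1..n}"
      using ij by auto
  next
    fix e assume "e \<in> (\<lambda>v. (v, f v)) ` {1..n}"
    then obtain v where v: "v \<in> {1..n}" "e = (v, f v)"
      by blast
    then show "e \<in> support E ?x"
      using fd[OF v(1)] pos[of v] by (auto simp: support_def tree_flow_def)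
  qed
  have val: "?x (u, f u) = real (branch_size ?T 0 u)" if "u \<in> {1..n}" for u
    using fd[OF that] by (simp add: tree_flow_def)
  have "(\<Sum>e\<in>dedges E. incidence v e * ?x e) = of_int (unit_netflow n v)" if v: "v \<in> {0..n}" for v
  proof -
    have "(\<Sum>e\<in>dedges E. incidence v e * ?x e) =
      (if v \<in> {1..n} then ?x (v, f v) else 0) - (\<Sum>u | u \<in> {1..n} \<and> f u = v. ?x (u, f u))"
      by (rule netflow_parent[OF fin nonneg supp])
    also have "(\<Sum>u | u \<in> {1..n} \<and> f u = v. ?x (u, f u))
        = real (\<Sum>u | u \<in> {1..n} \<and> f u = v. branch_size ?T 0 u)"
      using val by (simp only: of_nat_sum) (intro sum.cong refl, auto)
    \<comment> \<open>The branches of the children cover the branch of \<open>v\<close> except for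
      \<open>v\<close> itself. This 1 is the netflow at a positive \<open>v\<close>; at 0 it leaves
      an inflow of \<open>n + 1 - 1 = n\<close>.\<close>
    also have "\<dots> = real (branch_size ?T 0 v) - 1"
      using branch_size_parent[OF f T v] by simp
    finally have *: "(\<Sum>e\<in>dedges E. incidence v e * ?x e) =
      (if v \<in> {1..n} then ?x (v, f v) else 0) - (real (branch_size ?T 0 v) - 1)" .
    show ?thesis
    proof (cases "v = 0")
      case True
      have "branch_size ?T 0 0 = n + 1"
        using branch_size_root[OF TE(3,2), of 0] by simp
      then show ?thesis
        using * True by (simp add: unit_netflow_def)
    next
      case False
      then show ?thesis
        using * v val[of v] by (simp add: unit_netflow_def)
    qed
  qed
  moreover have "?x \<in> dedges E \<rightarrow>\<^sub>E {0..}"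
    using nonneg by (auto simp: tree_flow_def)
  moreover have "?x e \<in> \<int>" if "e \<in> dedges E" for e
    using that by (auto simp: tree_flow_def)
  ultimately show "?x \<in> lattice_flows n E (unit_netflow n)"
    by (auto simp: lattice_flows_def flow_polytope_def)
qed

lemma sum_parking_functions_eq_conn_enum:
  assumes E: "E \<subseteq> Pow {0..n}"
  shows "(\<Sum>P\<in>parking_functions n E. q ^ nat (codeg n E P)) = conn_enum q {0..n}"
proof -
  have V: "{0} \<union> {1..n} = {0..n}" "{0..n} - {0} = {1..n}"
    by auto
  have park: "parking_functions n E = rpark {0} {1..n} E"
    unfolding parking_functions_def rpark_def V(1) ..
  have "rooted_graph {0} {1..n} E"
  proof unfold_locales
    show "finite E"
      using E by (rule finite_subset) simp
    fix e assume e: "e \<in> E"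
    show "\<exists>a b. a \<noteq> b \<and> e = {a, b}"
      by (rule edge[OF e])
    show "e \<subseteq> {0} \<union> {1..n}"
      using E e unfolding V(1) by auto
    show "\<not> e \<subseteq> {0}"
      using edge[OF e] by auto
  qed auto
  then have "park_enum q {0} {1..n} E = rconn_enum q {0} {1..n} E"
    by (rule park_enum_eq_rconn_enum)
  also have "\<dots> = conn_enum q {0..n}"
    using rconn_enum_eq_conn_enum[of "{0..n}" 0 q] E unfolding V(2) by simp
  finally have "park_enum q {0} {1..n} E = conn_enum q {0..n}" .
  \<comment> \<open>Here \<open>card E - (n + 1) + 1\<close> is \<open>card E - n\<close>, and
    truncation at 0 agrees on both sides.\<close>
  moreover have "nat (codeg n E P) = card E - card {1..n} - (\<Sum>i\<in>{1..n}. P i)" for P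
    unfolding codeg_def by (simp del: of_nat_sum)
  ultimately show ?thesis
    by (simp only: park park_enum_def)
qed

end

text \<open>The flows surviving at \<open>t = 1\<close> correspond to the increasing trees: a flow
  goes to the tree of its support, a tree to the flow given by its branch sizes. The weights agree
  factor by factor.\<close>

lemma (in shifted_graph) poly_ehr_qt_eq_conn_enum:
  assumes E: "E \<subseteq> Pow {0..n}"
  shows "poly (ehr_qt n E (unit_netflow n)) 1 = conn_enum qvar {0..n}"
proof -
  let ?a = "unit_netflow n"
  have EV: "\<forall>e\<in>E. e \<subseteq> {0..n}"
    using E by auto
  have fin: "finite (dedges E)"
    using dedges_subset[OF EV] by (rule finite_subset) simp
  have a: "\<forall>v\<in>{1..n}. ?a v > 0"
    by (auto simp: unit_netflow_def)
  have ge: "n \<le> card (support E x)" if "x \<in> lattice_flows n E ?a" for x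
    using lattice_flow_support[OF EV a] that by (auto simp: lattice_flows_def support_def)
  let ?L = "{x \<in> lattice_flows n E ?a. card (support E x) = n}"
  let ?I = "{T \<in> trees {0..n}. increasing {0..n} T}"
  let ?w = "\<lambda>x. \<Prod>e\<in>support E x. qint qvar (nat \<lfloor>x e\<rfloor>)"
  have "poly (ehr_qt n E ?a) 1 = (\<Sum>x\<in>lattice_flows n E ?a. poly (wt_flow n E x) 1)"
    unfolding ehr_qt_def by (rule poly_sum)
  also have "\<dots> = (\<Sum>x\<in>lattice_flows n E ?a. if card (support E x) = n then ?w x else 0)"
    by (intro sum.cong refl poly_wt_flow[OF EV] ge)
  also have "\<dots> = (\<Sum>x\<in>?L. ?w x)"
    using finite_lattice_flows[OF EV] by (simp add: sum.inter_filter)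
  also have "\<dots> = (\<Sum>T\<in>?I. inc_weight qvar {0..n} T)"
  proof (rule sum.reindex_bij_witness[of _ "tree_flow E" "support_tree E"])
    fix x assume "x \<in> ?L"
    then have x: "x \<in> flow_polytope n E ?a" "card (support E x) = n"
      by (auto simp: lattice_flows_def)
    obtain f where f: "\<And>v. v \<in> {1..n} \<Longrightarrow> f v < v" and fE: "\<And>v. v \<in> {1..n} \<Longrightarrow> {v, f v} \<in> E"
      and supp: "support E x = (\<lambda>v. (v, f v)) ` {1..n}"
      using flow_support_parent[OF fin x(1) _ x(2)] a by blast
    let ?T = "parent_edges n f"
    note st = support_tree_parent[OF supp] and eq = flow_eq_tree_flow[OF E x(1) f fE supp]
    show "tree_flow E (support_tree E x) = x"
      unfolding st by (rule eq(2)[symmetric])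
    show T: "support_tree E x \<in> ?I"
      unfolding st using parent_edges_trees[OF f fE] increasing_parent_edges[OF f] by simp
    have "?w x = (\<Prod>v\<in>{1..n}. qint qvar (nat \<lfloor>x (v, f v)\<rfloor>))"
      unfolding supp by (subst prod.reindex) (auto simp: inj_on_def)
    also have "\<dots> = (\<Prod>v\<in>{1..n}. qint qvar (branch_size ?T 0 v))"
      using eq(1) by (intro prod.cong refl) (simp only: floor_of_nat nat_int)
    also have "\<dots> = inc_weight qvar {0..n} ?T"
    proof -
      have "{0..n} - {0} = {1..n}"
        by auto
      then show ?thesis
        using increasing_parent_edges[OF f] by (simp add: inc_weight_def Min_interval)
    qed
    finally show "inc_weight qvar {0..n} (support_tree E x) = ?w x"
      by (simp add: st)
  next
    fix T assume "T \<in> ?I"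
    then have T: "T \<in> trees {0..n}" "increasing {0..n} T"
      by auto
    obtain f where f: "\<And>v. v \<in> {1..n} \<Longrightarrow> f v < v" and TT: "T = parent_edges n f"
      using increasing_tree_parent[OF T] by blast
    note tf = tree_flow[OF E f T(1)[unfolded TT]]
    show "support_tree E (tree_flow E T) = T"
      unfolding TT by (rule support_tree_parent[OF tf(1)])
    have "card ((\<lambda>v. (v, f v)) ` {1..n}) = n"
      by (subst card_image) (auto simp: inj_on_def)
    then show "tree_flow E T \<in> ?L"
      using tf by (simp add: TT)
  qed
  also have "\<dots> = (\<Sum>T\<in>trees {0..n}. inc_weight qvar {0..n} T)"
    by (intro sum.mono_neutral_left) (auto simp: inc_weight_def)
  also have "\<dots> = conn_enum qvar {0..n}"
    by (rule sum_inc_weight) auto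
  finally show ?thesis .
qed

text \<open>Connectedness enters for the Tutte polynomial alone: on a disconnected graph its value
  at \<open>x = 1\<close> enumerates the edge sets with as many components as \<open>E\<close>,
  whereas the other four expressions are 0.\<close>

theorem theorem3p8:
  fixes n :: nat and E :: "nat set set"
  assumes "threshold_graph n E"
  shows "(connected_graph {0..n} E \<longrightarrow>
            poly (ehr_qt n E (\<lambda>i. if i = 0 then - int n else 1)) 1 = tutte {0..n} E 1 qvar) \<and>
         poly (ehr_qt n E (\<lambda>i. if i = 0 then - int n else 1)) 1 = inversion_enumerator n E qvar \<and>
         inversion_enumerator n E qvar = (\<Sum>T\<in>spanning_trees {0..n} E. qvar ^ inv_num T) \<and>
         (\<Sum>T\<in>spanning_trees {0..n} E. qvar ^ inv_num T)
           = (\<Sum>P\<in>parking_functions n E. qvar ^ nat (codeg n E P))"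
proof -
  interpret shifted_graph E
    using assms by (rule threshold_graph_shifted)
  have E: "E \<subseteq> Pow {0..n}"
    using threshold_edges[of "{0..n}" E] assms by (fastforce simp: threshold_graph_def)
  have "inversion_enumerator n E qvar = (\<Sum>T\<in>spanning_trees {0..n} E. qvar ^ inv_num T)"
    unfolding inversion_enumerator_def
    by (intro sum.cong refl) (auto simp: kappa_eq_inv_num spanning_trees_def)
  moreover have "(\<Sum>T\<in>spanning_trees {0..n} E. qvar ^ inv_num T) = conn_enum qvar {0..n}"
    using sum_trees_inversions[of "{0..n}" 0 qvar] spanning_trees_eq_trees[OF _ E]
    by (simp add: inv_num_eq)
  moreover have "poly (ehr_qt n E (\<lambda>i. if i = 0 then - int n else 1)) 1 = conn_enum qvar {0..n}"
    using poly_ehr_qt_eq_conn_enum[OF E] by (simp only: unit_netflow_def)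
  moreover have "(\<Sum>P\<in>parking_functions n E. qvar ^ nat (codeg n E P)) = conn_enum qvar {0..n}"
    by (rule sum_parking_functions_eq_conn_enum[OF E])
  moreover have "tutte {0..n} E 1 qvar = conn_enum qvar {0..n}" if "connected_graph {0..n} E"
    using that E by (intro tutte_1_eq_conn_enum) auto
  ultimately show ?thesis
    by simp
qed

end
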